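(* Let $k\ge3$ be an integer and let $n\ge \max\left\{\left\lceil 8k^3+\frac{k+1}{12}\right\rceil,\,526\right\}$ be an integer. Then $\Delta_k(n)^2\ge \Delta_k(n-1)\,\Delta_k(n+1)$.
   Context: For an integer $k\ge1$, $\Delta_k(n)$ is defined by $\sum_{n\ge0}\Delta_k(n)q^n=\prod_{m\ge1}\frac{(1-q^{2m})(1-q^{(2k+1)m})}{(1-q^m)^3(1-q^{(4k+2)m})}$. *)

theory Defs
  imports "HOL-Computational_Algebra.Formal_Power_Series"
begin

definition Delta_factor :: "nat \<Rightarrow> nat \<Rightarrow> real fps" where
  "Delta_factor k m =
     (1 - fps_X ^ (2 * m)) * (1 - fps_X ^ ((2 * k + 1) * m)) *
     inverse ((1 - fps_X ^ m) ^ 3 * (1 - fps_X ^ ((4 * k + 2) * m)))"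

text \<open>For m > n the m-th factor is 1 + O(q^m), so the coefficient of q^n in the
  infinite product over m \<ge> 1 equals the coefficient of q^n in the finite product over 1 \<le> m \<le> n.\<close>
definition Delta :: "nat \<Rightarrow> nat \<Rightarrow> real" where
  "Delta k n = fps_nth (\<Prod>m\<in>{1..n}. Delta_factor k m) n"

end

theory Submission
  imports Defs "HOL-Complex_Analysis.Complex_Analysis"
begin

text \<open>Up to any order, Delta k is the coefficient sequence of
  $F(q) = \prod_{m \le N} (1-q^m)^{-c_m}$ with $c_m \in \{2,3\}$, and this is the only property of
  k that matters. By the inequality of arithmetic and geometric means, log-concavity at n follows from
  $2 e_n r^n \ge e_{n-1} r^{n-1} + e_{n+1} r^{n+1}$ for a single radius r, where $e_i$ are the
  coefficients of F. By Cauchy's formula this says that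
  $\int_0^\pi \mathrm{Re}(F(r e^{i\theta}) e^{-in\theta})\,(1-\cos\theta)\,d\theta \ge 0$.
  Take $r = e^{-s}$ to be the saddle point. After division by F(r), the modulus of the integrand is
  $e^{-D(\theta)}$ and its phase vanishes to third order at 0. Bounds for the sums over m, obtained by
  interchanging them with the power series of their terms, give
  $D \le \pi^2\theta^2/(2s^3)$ and a phase of at most $5.1\,\theta^3/s^4$, so the integrand is positive for
  $\theta \le 0.99\,s^{3/2}$. For larger $\theta$ the first four terms of the power series of
  $\log(1-q^m)$ already bound D from below well enough. For $n \ge 526$ one has $s \le 0.0969$, and with
  this the positive part of the integral dominates.\<close>

section \<open>Power sums at an exponential argument\<close>

text \<open>The factor 1 - cos \<theta> removes the peak of F at 0, so the mass of the integral lies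
  at \<theta> of size s^(3/2), where the phase is harmless only if s is small. With t = sqrt s and
  \<theta> = t^3 y the upper bound for the decay becomes 4.935 y^2 and the phase bound 5.1 t y^3,
  and every part of the integral is measured in units of t^9. Upper bounds use c_m \<le> 3 and lower
  bounds c_m \<ge> 2; this loss, together with keeping only four terms of the logarithm, weakens the
  exponent 4.935 y^2 to 2.76 y^2 / (1 + s y^2) in the tail. The final balance is 0.0160 against
  0.0140 + 0.0005 + 0.0008, so the numerical constants have little slack. The size of n enters
  through s: the saddle equation gives n s^2 \<le> pi^2 / 2, hence s \<le> 0.0969 from n = 526
  on.\<close>

lemma sum_nat_mult_power_le:
  fixes R :: real
  assumes "0 \<le> R" "R < 1"
  shows "(\<Sum>m=1..N. real m * R ^ m) \<le> R / (1 - R)\<^sup>2"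
proof -
  define S0 S1 where "S0 = inverse (1 - R)" and "S1 = R * S0\<^sup>2"
  \<comment> \<open>\<open>S0\<close> and \<open>S1\<close> are the full sums of R^i and i R^i, so
    \<open>T m\<close> is the closed form of the tail over i \<ge> m of i R^i. Its differences
    telescope, and dropping a nonnegative tail gives the bound. The square and cube versions use the
    same device with (m + i)^2 and (m + i)^3 expanded.\<close>
  define T where "T m = R ^ m * (real m * S0 + S1)" for m
  have D: "(1 - R) * S0 = 1" using assms by (simp add: S0_def)
  then have S0: "S0 = 1 + R * S0" by algebra
  have S1: "S1 = R * (S0 + S1)" using D unfolding S1_def by algebra
  have nn: "S0 \<ge> 0" "S1 \<ge> 0" using assms by (auto simp: S1_def S0_def)
  have step: "T m - T (Suc m) = real m * R ^ m" for m
  proof -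
    have "T m - T (Suc m) = R ^ m * (real m * (S0 - R * S0) + (S1 - R * (S0 + S1)))"
      by (simp add: T_def algebra_simps)
    then show ?thesis using S0 S1 by simp
  qed
  have "(\<Sum>m=1..N. real m * R ^ m) = S1 - T (Suc N)"
  proof (induction N)
    case 0
    show ?case using step[of 0] by (simp add: T_def)
  next
    case (Suc N)
    then show ?case using step[of "Suc N"] by simp
  qed
  moreover have "T (Suc N) \<ge> 0" using assms nn by (simp add: T_def)
  ultimately show ?thesis by (simp add: S1_def S0_def divide_inverse power_inverse)
qed

text \<open>An exact sum and not only a bound: with R = r^m it is also the expansion of the summand
  in \<open>cumulant3_sum_le\<close>.\<close>

lemma nat_square_mult_power_sums:
  fixes R :: real
  assumes "0 \<le> R" "R < 1"
  shows "(\<lambda>m. (real m)\<^sup>2 * R ^ m) sums (R * (1 + R) / (1 - R) ^ 3)"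
proof -
  define S0 S1 S2 where "S0 = inverse (1 - R)" and "S1 = R * S0\<^sup>2"
    and "S2 = R * (1 + R) * S0 ^ 3"
  define T where "T m = R ^ m * ((real m)\<^sup>2 * S0 + 2 * real m * S1 + S2)" for m
  have D: "(1 - R) * S0 = 1" using assms by (simp add: S0_def)
  then have S0: "S0 = 1 + R * S0" by algebra
  have S1: "S1 = R * (S0 + S1)" using D unfolding S1_def by algebra
  have S2: "S2 = R * (S0 + 2 * S1 + S2)" using D unfolding S2_def S1_def by algebra
  have step: "T m - T (Suc m) = (real m)\<^sup>2 * R ^ m" for m
  proof -
    have "T m - T (Suc m) = R ^ m * ((real m)\<^sup>2 * (S0 - R * S0) + 2 * real m * (S1 - R * (S0 + S1))
        + (S2 - R * (S0 + 2 * S1 + S2)))"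
      by (simp add: T_def algebra_simps power2_eq_square)
    then show ?thesis using S0 S1 S2 by simp
  qed
  have eq: "(\<Sum>m<N. (real m)\<^sup>2 * R ^ m) = S2 - T N" for N
  proof (induction N)
    case 0
    show ?case by (simp add: T_def)
  next
    case (Suc N)
    then show ?case using step[of "N"] by simp
  qed
  have l1: "(\<lambda>n. real n * R ^ n) \<longlonglongrightarrow> 0"
    using powser_times_n_limit_0[of R] assms by simp
  have l0: "(\<lambda>n. R ^ n) \<longlonglongrightarrow> 0"
    using LIMSEQ_realpow_zero assms by blast
  \<comment> \<open>n^2 R^n is the square of n (sqrt R)^n, which reduces its limit to the linear
    case.\<close>
  have "(\<lambda>n. real n * sqrt R ^ n) \<longlonglongrightarrow> 0"
    using powser_times_n_limit_0[of "sqrt R"] assms by simp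
  from tendsto_power[OF this, of 2]
  have l2: "(\<lambda>n. (real n)\<^sup>2 * R ^ n) \<longlonglongrightarrow> 0"
    using assms by (simp add: power_mult_distrib power_mult[symmetric] mult.commute[of _ 2])
       (simp add: power_mult)
  have "(\<lambda>n. ((real n)\<^sup>2 * R ^ n) * S0 + 2 * (real n * R ^ n) * S1 + R ^ n * S2) \<longlonglongrightarrow> 0 * S0 + 2 * 0 * S1 + 0 * S2"
    by (intro tendsto_intros l0 l1 l2)
  then have "T \<longlonglongrightarrow> 0"
    by (simp add: T_def[abs_def] algebra_simps)
  then have "(\<lambda>N. S2 - T N) \<longlonglongrightarrow> S2 - 0"
    by (intro tendsto_intros)
  then show ?thesis
    by (simp add: sums_def eq) (simp add: S2_def S0_def divide_inverse power_inverse)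
qed

lemma sum_square_mult_power_le:
  fixes R :: real
  assumes "0 \<le> R" "R < 1"
  shows "(\<Sum>m=1..N. (real m)\<^sup>2 * R ^ m) \<le> R * (1 + R) / (1 - R) ^ 3"
proof -
  have "(\<Sum>m=1..N. (real m)\<^sup>2 * R ^ m) \<le> (\<Sum>m. (real m)\<^sup>2 * R ^ m)"
    using nat_square_mult_power_sums[OF assms] assms
    by (intro sum_le_suminf) (auto simp: sums_iff)
  then show ?thesis
    using nat_square_mult_power_sums[OF assms] by (simp add: sums_iff)
qed

lemma sum_cube_mult_power_le:
  fixes R :: real
  assumes "0 \<le> R" "R < 1"
  shows "(\<Sum>m=1..N. real m ^ 3 * R ^ m) \<le> R * (1 + 4 * R + R\<^sup>2) / (1 - R) ^ 4"
proof -
  define S0 S1 S2 S3 where "S0 = inverse (1 - R)" and "S1 = R * S0\<^sup>2"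
    and "S2 = R * (1 + R) * S0 ^ 3" and "S3 = R * (1 + 4 * R + R\<^sup>2) * S0 ^ 4"
  define T where "T m = R ^ m * (real m ^ 3 * S0 + 3 * (real m)\<^sup>2 * S1 + 3 * real m * S2 + S3)" for m
  have D: "(1 - R) * S0 = 1" using assms by (simp add: S0_def)
  then have S0: "S0 = 1 + R * S0" by algebra
  have S1: "S1 = R * (S0 + S1)" using D unfolding S1_def by algebra
  have S2: "S2 = R * (S0 + 2 * S1 + S2)" using D unfolding S2_def S1_def by algebra
  have S3: "S3 = R * (S0 + 3 * S1 + 3 * S2 + S3)" using D unfolding S3_def S1_def S2_def by algebra
  have nn: "S0 \<ge> 0" "S1 \<ge> 0" "S2 \<ge> 0" "S3 \<ge> 0" using assms by (auto simp: S0_def S1_def S2_def S3_def)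
  have step: "T m - T (Suc m) = real m ^ 3 * R ^ m" for m
  proof -
    have "T m - T (Suc m) = R ^ m * (real m ^ 3 * (S0 - R * S0) + 3 * (real m)\<^sup>2 * (S1 - R * (S0 + S1))
        + 3 * real m * (S2 - R * (S0 + 2 * S1 + S2)) + (S3 - R * (S0 + 3 * S1 + 3 * S2 + S3)))"
      by (simp add: T_def algebra_simps power2_eq_square power3_eq_cube)
    then show ?thesis using S0 S1 S2 S3 by simp
  qed
  have "(\<Sum>m=1..N. real m ^ 3 * R ^ m) = S3 - T (Suc N)"
  proof (induction N)
    case 0
    show ?case using step[of 0] by (simp add: T_def)
  next
    case (Suc N)
    then show ?case using step[of "Suc N"] by simp
  qed
  moreover have "T (Suc N) \<ge> 0" using assms nn by (simp add: T_def)
  ultimately show ?thesis by (simp add: S3_def S0_def divide_inverse power_inverse)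
qed

section \<open>Comparison of exponential quotients with inverse powers\<close>

lemma cosh_taylor_le:
  fixes u :: real
  shows "1 + u\<^sup>2 / 2 + u ^ 4 / 24 + u ^ 6 / 720 \<le> cosh u"
proof -
  let ?f = "\<lambda>n. if even n then u ^ n /\<^sub>R fact n else 0"
  have "(\<Sum>n\<in>{0,2,4,6}. ?f n) \<le> (\<Sum>n. ?f n)"
    using cosh_converges[of u] by (intro sum_le_suminf) (auto simp: sums_iff)
  also have "\<dots> = cosh u" using cosh_converges[of u] by (simp add: sums_iff)
  also have "(\<Sum>n\<in>{0,2,4,6}. ?f n) = 1 + u\<^sup>2 / 2 + u ^ 4 / 24 + u ^ 6 / 720"
    by (simp add: fact_numeral)
  finally show ?thesis .
qed

lemma exp_neg_ratio:
  fixes u :: real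
  shows "(1 - exp (-u))\<^sup>2 / exp (-u) = 2 * cosh u - 2"
  by (simp add: cosh_field_def power2_eq_square exp_minus) (simp add: field_simps)

lemma exp_ratio1:
  fixes u :: real
  assumes "u > 0"
  shows "exp (-u) / (1 - exp (-u))\<^sup>2 \<le> 1 / u\<^sup>2"
proof -
  have "u\<^sup>2 \<le> 2 * cosh u - 2" using cosh_taylor_le[of u] by (simp add: field_simps)
     (smt (verit) zero_le_even_power even_numeral)
  then have "u\<^sup>2 \<le> (1 - exp (-u))\<^sup>2 / exp (-u)" by (simp add: exp_neg_ratio)
  then have "inverse ((1 - exp (-u))\<^sup>2 / exp (-u)) \<le> inverse (u\<^sup>2)"
    using assms by (intro le_imp_inverse_le) auto
  then show ?thesis by (simp add: field_simps)
qed

text \<open>The left side is odd in u, but its square is the rational function (h + 4) / h^3 of h =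
  2 cosh u - 2, which decreases in h. With U = u^2, two Taylor terms h \<ge> U + U^2/12 suffice,
  because 4 (1 + U/12)^3 exceeds 4 + U + U^2/12 by exactly U^3/432.\<close>

lemma exp_ratio2:
  fixes u :: real
  assumes "u > 0"
  defines "R \<equiv> exp (-u)"
  shows "R * (1 + R) / (1 - R) ^ 3 \<le> 2 / u ^ 3"
proof -
  have R: "0 < R" "R < 1" using assms by auto
  define h where "h = (1 - R)\<^sup>2 / R"
  define U where "U = u\<^sup>2"
  have U: "U > 0" using assms by (simp add: U_def)
  have "1 + U / 2 + U\<^sup>2 / 24 + U ^ 3 / 720 \<le> cosh u"
    using cosh_taylor_le[of u] by (simp add: U_def)
  moreover have "h = 2 * cosh u - 2"
    using exp_neg_ratio[of u] by (simp add: h_def R_def)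
  moreover have "U ^ 3 \<ge> 0" using U by simp
  ultimately have h: "h \<ge> U + U\<^sup>2 / 12" by linarith
  have hU: "h > 0" using R by (simp add: h_def)
  have sq': "(1 - R)\<^sup>2 = h * R" using R by (simp add: h_def)
  have sq: "(1 + R)\<^sup>2 = h * R + 4 * R" using sq' by (simp add: power2_eq_square algebra_simps)
  have "(R * (1 + R) / (1 - R) ^ 3)\<^sup>2 = R\<^sup>2 * (1 + R)\<^sup>2 / ((1 - R)\<^sup>2) ^ 3"
    by (simp add: power_divide power_mult_distrib flip: power_mult)
  also have "\<dots> = (R ^ 3 * (h + 4)) / (R ^ 3 * h ^ 3)"
    unfolding sq sq' by (simp add: power_mult_distrib power2_eq_square power3_eq_cube algebra_simps)
  also have "\<dots> = (h + 4) / h ^ 3"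
    using R by simp
  also have "\<dots> \<le> 4 / U ^ 3"
  proof -
    define g where "g = U + U\<^sup>2 / 12"
    have g: "g > 0" "g \<le> h" using U h by (auto simp: g_def add_pos_nonneg)
    have split: "(x + 4) / x ^ 3 = 1 / x\<^sup>2 + 4 / x ^ 3" if "x > 0" for x :: real
      using that by (simp add: add_divide_distrib power2_eq_square power3_eq_cube)
    have "(h + 4) / h ^ 3 = 1 / h\<^sup>2 + 4 / h ^ 3" by (rule split[OF hU])
    also have "\<dots> \<le> 1 / g\<^sup>2 + 4 / g ^ 3"
      using g by (intro add_mono divide_left_mono power_mono) auto
    also have "\<dots> = (g + 4) / g ^ 3" by (rule split[symmetric, OF g(1)])
    also have "\<dots> \<le> 4 / U ^ 3"
    proof -
      have "(g + 4) * U ^ 3 \<le> 4 * g ^ 3"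
      proof -
        have "4 * g ^ 3 - (g + 4) * U ^ 3 = U ^ 3 * (4 * (1 + U / 12) ^ 3 - (g + 4))"
          by (simp add: g_def power2_eq_square power3_eq_cube algebra_simps)
        moreover have "4 * (1 + U / 12) ^ 3 - (g + 4) = U ^ 3 / 432"
          by (simp add: g_def power2_eq_square power3_eq_cube algebra_simps)
        moreover have "U ^ 3 * (U ^ 3 / 432) \<ge> 0" using U by simp
        ultimately have "4 * g ^ 3 - (g + 4) * U ^ 3 \<ge> 0" by metis
        then show ?thesis by simp
      qed
      then show ?thesis using g U
        by (simp add: pos_divide_le_eq pos_le_divide_eq)
    qed
    finally show ?thesis .
  qed
  also have "\<dots> = (2 / u ^ 3)\<^sup>2" by (simp add: U_def power_divide flip: power_mult)
  finally show ?thesis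
    by (rule power2_le_imp_le) (use \<open>u > 0\<close> in simp)
qed

text \<open>In terms of h = 2 cosh u - 2 the left side is 1/h + 6/h^2. It behaves like 6/u^4 + 1/120
  as u tends to 0, so the numerator 6 would be too small; 31/5 leaves room for a polynomial
  comparison.\<close>

lemma exp_ratio3:
  fixes u :: real
  assumes "u > 0"
  defines "R \<equiv> exp (-u)"
  shows "R * (1 + 4 * R + R\<^sup>2) / (1 - R) ^ 4 \<le> (31/5) / u ^ 4"
proof -
  have R: "0 < R" "R < 1" using assms by auto
  define h where "h = (1 - R)\<^sup>2 / R"
  define U where "U = u\<^sup>2"
  have U: "U > 0" using assms by (simp add: U_def)
  have "1 + U / 2 + U\<^sup>2 / 24 + U ^ 3 / 720 \<le> cosh u"
    using cosh_taylor_le[of u] by (simp add: U_def)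
  moreover have "h = 2 * cosh u - 2"
    using exp_neg_ratio[of u] by (simp add: h_def R_def)
  ultimately have h: "h \<ge> U + U\<^sup>2 / 12 + U ^ 3 / 360" by linarith
  have hU: "h > 0" using R by (simp add: h_def)
  have sq': "(1 - R)\<^sup>2 = h * R" using R by (simp add: h_def)
  have sq: "1 + 4 * R + R\<^sup>2 = h * R + 6 * R" using sq' by (simp add: power2_eq_square algebra_simps)
  have "(1 - R) ^ 4 = ((1 - R)\<^sup>2)\<^sup>2" by simp
  then have "R * (1 + 4 * R + R\<^sup>2) / (1 - R) ^ 4 = R * (h * R + 6 * R) / (h * R)\<^sup>2"
    by (simp only: sq sq')
  also have "\<dots> = 1 / h + 6 / h\<^sup>2"
    using R hU by (simp add: divide_simps) (simp add: power2_eq_square algebra_simps)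
  also have "\<dots> \<le> (31/5) / U\<^sup>2"
  proof -
    define k where "k = 1 + U / 12 + U\<^sup>2 / 360"
    define g where "g = U * k"
    have k: "k > 0" using U by (auto simp: k_def add_pos_nonneg)
    have g: "g > 0" using U k by (simp add: g_def)
    have "g = U + U\<^sup>2 / 12 + U ^ 3 / 360"
      by (simp add: g_def k_def power2_eq_square power3_eq_cube algebra_simps)
    with h g have g: "g > 0" "g \<le> h" by simp_all
    have "1 / h + 6 / h\<^sup>2 \<le> 1 / g + 6 / g\<^sup>2"
      using g by (intro add_mono divide_left_mono power_mono) auto
    also have "\<dots> \<le> (31/5) / U\<^sup>2"
    proof -
      have "U * k + 6 \<le> (31/5) * k\<^sup>2"
      proof -
        have "(31/5) * k\<^sup>2 - (U * k + 6) = 1/5 + U / 30 - (7/1200) * U\<^sup>2 + U ^ 3 * (31 / 10800 - 1/360) + 31/648000 * U ^ 4"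
          by (simp add: k_def power2_eq_square power3_eq_cube power4_eq_xxxx algebra_simps)
        \<comment> \<open>Up to U = 20, completing the square in U^2 uses most of the quartic term
          and leaves a quadratic that is nonnegative on this range; beyond 20 the quartic term
          outweighs the negative square term.\<close>
        moreover have "1/5 + U / 30 - (7/1200) * U\<^sup>2 + 31/648000 * U ^ 4 \<ge> 0"
        proof (cases "U \<le> 20")
          case True
          then have "U * U \<le> 20 * U" using U by (intro mult_right_mono) auto
          then have "(2/375 - 7/1200) * U\<^sup>2 + U/30 + 1/25 \<ge> 0"
            using U by (simp add: power2_eq_square)
          moreover have "1/5 + U / 30 - (7/1200) * U\<^sup>2 + 31/648000 * U ^ 4
              = (U\<^sup>2 * (1/150) - 2/5)\<^sup>2 + (31/648000 - 1/22500) * U ^ 4 + ((2/375 - 7/1200) * U\<^sup>2 + U/30 + 1/25)"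
            by (simp add: power2_eq_square power4_eq_xxxx algebra_simps)
          moreover have "(31/648000 - 1/22500) * U ^ 4 \<ge> 0"
            using U by simp
          ultimately show ?thesis by (metis add_nonneg_nonneg zero_le_power2)
        next
          case False
          have "U ^ 4 = U\<^sup>2 * U\<^sup>2" by (simp flip: power_add)
          moreover have "U\<^sup>2 \<ge> 400" using False power_mono[of 20 U 2] by simp
          then have "U\<^sup>2 * U\<^sup>2 \<ge> 400 * U\<^sup>2" by (intro mult_right_mono) auto
          ultimately show ?thesis using U \<open>U\<^sup>2 \<ge> 400\<close> by linarith
        qed
        moreover have "U ^ 3 * (31 / 10800 - 1/360) \<ge> 0" using U by simp
        ultimately show ?thesis by linarith
      qed
      then have "(U * k + 6) / (U * k)\<^sup>2 \<le> ((31/5) * k\<^sup>2) / (U * k)\<^sup>2" by (intro divide_right_mono) auto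
      moreover have "(U * k + 6) / (U * k)\<^sup>2 = 1 / g + 6 / g\<^sup>2"
        using g by (simp add: g_def[symmetric] divide_simps power2_eq_square)
      moreover have "((31/5) * k\<^sup>2) / (U * k)\<^sup>2 = (31/5) / U\<^sup>2" using k U by (simp add: power2_eq_square)
      ultimately show ?thesis by simp
    qed
    finally show ?thesis .
  qed
  also have "\<dots> = (31/5) / u ^ 4" by (simp add: U_def)
  finally show ?thesis .
qed

section \<open>Sums over m through interchange with a series in j\<close>

lemma sum_le_of_double_series:
  fixes g :: "nat \<Rightarrow> nat \<Rightarrow> real"
  assumes "\<And>m. m \<in> A \<Longrightarrow> g m sums G m"
    and "\<And>j. (\<Sum>m\<in>A. g m j) \<le> C / (real (Suc j))\<^sup>2"
  shows "(\<Sum>m\<in>A. G m) \<le> C * pi\<^sup>2 / 6"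
proof -
  have "(\<lambda>j. \<Sum>m\<in>A. g m j) sums (\<Sum>m\<in>A. G m)"
    by (intro sums_sum assms(1))
  moreover have "(\<lambda>j. C * (1 / (real (Suc j))\<^sup>2)) sums (C * (pi\<^sup>2 / 6))"
    using inverse_squares_sums by (intro sums_mult) simp
  then have "(\<lambda>j. C / (real (Suc j))\<^sup>2) sums (C * pi\<^sup>2 / 6)"
    by (simp only: times_divide_eq_right mult_1_right)
  ultimately show ?thesis
    by (rule sums_le[OF assms(2)])
qed

lemma power_swap: "((x::real) ^ m) ^ j = (x ^ j) ^ m"
  by (metis power_mult mult.commute)

context
  fixes s r :: real
  assumes s: "s > 0" and r: "r = exp (-s)"
begin

lemma r_bounds: "0 < r" "r < 1"
  using s by (auto simp: r)

lemma r_pow: "r ^ j = exp (- (real j * s))"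
  by (simp add: r exp_of_nat_mult[symmetric])

lemma r_pow_bounds: "m \<ge> 1 \<Longrightarrow> 0 < r ^ m \<and> r ^ m < 1"
  using s by (simp add: r_pow)

text \<open>This sum and the next two are, up to sign, the first three derivatives in s of the sum
  of - ln (1 - r^m). Expanded in powers (r^m)^j and summed over m first, the weights 1, j, j^2 meet
  power sums of order (j s)^-2, (j s)^-3, (j s)^-4, so each column is a multiple of 1/j^2 and pi^2/6
  appears every time.\<close>

lemma mean_sum_le: "(\<Sum>m=1..N. real m * (r ^ m / (1 - r ^ m))) \<le> pi\<^sup>2 / (6 * s\<^sup>2)"
proof -
  have "(\<Sum>m=1..N. real m * (r ^ m / (1 - r ^ m))) \<le> (1 / s\<^sup>2) * pi\<^sup>2 / 6"
  proof (rule sum_le_of_double_series)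
    fix m assume m: "m \<in> {1..N}"
    have "(\<lambda>j. (r ^ m) ^ j) sums (1 / (1 - r ^ m))"
      using r_pow_bounds[of m] m by (intro geometric_sums) auto
    from sums_mult[OF this, of "real m * r ^ m"]
    show "(\<lambda>j. real m * (r ^ m) ^ Suc j) sums (real m * (r ^ m / (1 - r ^ m)))"
      by (simp add: mult_ac)
  next
    fix j
    have "(\<Sum>m=1..N. real m * (r ^ m) ^ Suc j) = (\<Sum>m=1..N. real m * (r ^ Suc j) ^ m)"
      by (intro sum.cong refl) (simp only: power_swap[of r _ "Suc j"])
    also have "\<dots> \<le> r ^ Suc j / (1 - r ^ Suc j)\<^sup>2"
      using r_pow_bounds[of "Suc j"] by (intro sum_nat_mult_power_le) auto
    also have "\<dots> \<le> 1 / (real (Suc j) * s)\<^sup>2"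
      unfolding r_pow using s by (intro exp_ratio1) auto
    finally show "(\<Sum>m=1..N. real m * (r ^ m) ^ Suc j) \<le> (1 / s\<^sup>2) / (real (Suc j))\<^sup>2"
      by (simp add: power_mult_distrib mult.commute)
  qed
  then show ?thesis by (simp add: field_simps)
qed

lemma variance_sum_le: "(\<Sum>m=1..N. (real m)\<^sup>2 * (r ^ m / (1 - r ^ m)\<^sup>2)) \<le> pi\<^sup>2 / (3 * s ^ 3)"
proof -
  have "(\<Sum>m=1..N. (real m)\<^sup>2 * (r ^ m / (1 - r ^ m)\<^sup>2)) \<le> (2 / s ^ 3) * pi\<^sup>2 / 6"
  proof (rule sum_le_of_double_series)
    fix m assume m: "m \<in> {1..N}"
    have "(\<lambda>j. of_nat (Suc j) * (r ^ m) ^ j) sums (1 / (1 - r ^ m)\<^sup>2)"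
      using r_pow_bounds[of m] m by (intro geometric_deriv_sums) auto
    from sums_mult[OF this, of "(real m)\<^sup>2 * r ^ m"]
    show "(\<lambda>j. real (Suc j) * ((real m)\<^sup>2 * (r ^ m) ^ Suc j)) sums ((real m)\<^sup>2 * (r ^ m / (1 - r ^ m)\<^sup>2))"
      by (simp add: mult_ac)
  next
    fix j
    have "(\<Sum>m=1..N. real (Suc j) * ((real m)\<^sup>2 * (r ^ m) ^ Suc j)) = real (Suc j) * (\<Sum>m=1..N. (real m)\<^sup>2 * (r ^ Suc j) ^ m)"
      unfolding sum_distrib_left by (intro sum.cong refl) (simp only: power_swap[of r _ "Suc j"])
    also have "\<dots> \<le> real (Suc j) * (r ^ Suc j * (1 + r ^ Suc j) / (1 - r ^ Suc j) ^ 3)"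
      using r_pow_bounds[of "Suc j"] by (intro mult_left_mono sum_square_mult_power_le) auto
    also have "\<dots> \<le> real (Suc j) * (2 / (real (Suc j) * s) ^ 3)"
      unfolding r_pow using s by (intro mult_left_mono exp_ratio2) auto
    also have "\<dots> = (2 / s ^ 3) / (real (Suc j))\<^sup>2"
      by (simp add: power2_eq_square power3_eq_cube divide_simps del: of_nat_Suc)
    finally show "(\<Sum>m=1..N. real (Suc j) * ((real m)\<^sup>2 * (r ^ m) ^ Suc j)) \<le> (2 / s ^ 3) / (real (Suc j))\<^sup>2" .
  qed
  then show ?thesis by (simp add: field_simps)
qed

lemma cumulant3_sum_le:
  "(\<Sum>m=1..N. real m ^ 3 * (r ^ m * (1 + r ^ m) / (1 - r ^ m) ^ 3)) \<le> 31 * pi\<^sup>2 / (30 * s ^ 4)"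
proof -
  have "(\<Sum>m=1..N. real m ^ 3 * (r ^ m * (1 + r ^ m) / (1 - r ^ m) ^ 3)) \<le> ((31/5) / s ^ 4) * pi\<^sup>2 / 6"
  proof (rule sum_le_of_double_series)
    fix m assume m: "m \<in> {1..N}"
    have "(\<lambda>j. (real j)\<^sup>2 * (r ^ m) ^ j) sums (r ^ m * (1 + r ^ m) / (1 - r ^ m) ^ 3)"
      using r_pow_bounds[of m] m by (intro nat_square_mult_power_sums) auto
    from sums_mult[OF this, of "real m ^ 3"]
    have "(\<lambda>j. (real j)\<^sup>2 * (real m ^ 3 * (r ^ m) ^ j)) sums (real m ^ 3 * (r ^ m * (1 + r ^ m) / (1 - r ^ m) ^ 3))"
      by (simp add: mult_ac)
    \<comment> \<open>The term at j = 0 vanishes, so the series may start at 1.\<close>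
    then show "(\<lambda>j. (real (Suc j))\<^sup>2 * (real m ^ 3 * (r ^ m) ^ Suc j)) sums (real m ^ 3 * (r ^ m * (1 + r ^ m) / (1 - r ^ m) ^ 3))"
      using sums_Suc_iff[of "\<lambda>j. (real j)\<^sup>2 * (real m ^ 3 * (r ^ m) ^ j)" "real m ^ 3 * (r ^ m * (1 + r ^ m) / (1 - r ^ m) ^ 3)"] by simp
  next
    fix j
    have "(\<Sum>m=1..N. (real (Suc j))\<^sup>2 * (real m ^ 3 * (r ^ m) ^ Suc j)) = (real (Suc j))\<^sup>2 * (\<Sum>m=1..N. real m ^ 3 * (r ^ Suc j) ^ m)"
      unfolding sum_distrib_left by (intro sum.cong refl) (simp only: power_swap[of r _ "Suc j"])
    also have "\<dots> \<le> (real (Suc j))\<^sup>2 * (r ^ Suc j * (1 + 4 * r ^ Suc j + (r ^ Suc j)\<^sup>2) / (1 - r ^ Suc j) ^ 4)"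
      using r_pow_bounds[of "Suc j"] by (intro mult_left_mono sum_cube_mult_power_le) auto
    also have "\<dots> \<le> (real (Suc j))\<^sup>2 * ((31/5) / (real (Suc j) * s) ^ 4)"
      unfolding r_pow using s by (intro mult_left_mono exp_ratio3) auto
    also have "\<dots> = ((31/5) / s ^ 4) / (real (Suc j))\<^sup>2"
      by (simp add: power2_eq_square power4_eq_xxxx divide_simps del: of_nat_Suc)
    finally show "(\<Sum>m=1..N. (real (Suc j))\<^sup>2 * (real m ^ 3 * (r ^ m) ^ Suc j)) \<le> ((31/5) / s ^ 4) / (real (Suc j))\<^sup>2" .
  qed
  then show ?thesis by (simp add: field_simps)
qed

end

section \<open>The generating function\<close>

text \<open>Congruence modulo X^(N+1), in which truncations of a product at different lengths can be
  compared.\<close>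

definition fps_agree :: "nat \<Rightarrow> 'a::comm_ring_1 fps \<Rightarrow> 'a fps \<Rightarrow> bool" where
  "fps_agree N f g \<longleftrightarrow> (\<forall>i\<le>N. fps_nth f i = fps_nth g i)"

lemma fps_agree_refl [simp]: "fps_agree N f f"
  by (simp add: fps_agree_def)

lemma fps_agree_mult: "fps_agree N f f' \<Longrightarrow> fps_agree N g g' \<Longrightarrow> fps_agree N (f * g) (f' * g')"
  by (auto simp: fps_agree_def fps_mult_nth intro!: sum.cong)

lemma fps_agree_power: "fps_agree N f f' \<Longrightarrow> fps_agree N (f ^ k) (f' ^ k)"
  by (induction k) (auto intro: fps_agree_mult)

lemma fps_agree_prod: "(\<And>m. m \<in> A \<Longrightarrow> fps_agree N (f m) (g m)) \<Longrightarrow> fps_agree N (\<Prod>m\<in>A. f m) (\<Prod>m\<in>A. g m)"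
  by (induction A rule: infinite_finite_induct) (auto intro: fps_agree_mult)

text \<open>1/f = (1/f) g (1/g) and 1/g = (1/f) f (1/g) differ only in the middle factor, so
  compatibility with products is enough.\<close>

lemma fps_agree_inverse:
  fixes f g :: "'a::field fps"
  assumes "fps_agree N f g" "fps_nth f 0 \<noteq> 0"
  shows "fps_agree N (inverse f) (inverse g)"
proof -
  have g0: "fps_nth g 0 \<noteq> 0" using assms by (auto simp: fps_agree_def)
  have "fps_agree N (inverse f * (g * inverse g)) (inverse f * (f * inverse g))"
    using assms(1) by (intro fps_agree_mult) (auto simp: fps_agree_def)
  also have "inverse f * (f * inverse g) = inverse g"
    using assms(2) by (simp add: inverse_mult_eq_1 flip: mult.assoc)
  also have "g * inverse g = 1" using g0 by (simp add: inverse_mult_eq_1')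
  finally show ?thesis by simp
qed

lemma fps_agree_one_minus_X_power:
  "N < m \<Longrightarrow> fps_agree N (1 - fps_X ^ m) (1 :: 'a::comm_ring_1 fps)"
  by (auto simp: fps_agree_def fps_X_power_nth)

text \<open>Factors with d m > N are 1 up to order N, and m \<mapsto> d m maps the others onto the
  multiples of d up to N. This puts the four products of the generating function on one index set,
  where they combine factor by factor.\<close>

lemma fps_agree_prod_one_minus_X_power:
  assumes d: "d > 0"
  shows "fps_agree N (\<Prod>m\<in>{1..N}. 1 - fps_X ^ (d * m))
           (\<Prod>m\<in>{1..N}. if d dvd m then 1 - fps_X ^ m else (1 :: 'a::comm_ring_1 fps))"
proof -
  have "fps_agree N (\<Prod>m\<in>{1..N}. 1 - fps_X ^ (d * m))
          (\<Prod>m\<in>{1..N}. if d * m \<le> N then 1 - fps_X ^ (d * m) else (1 :: 'a fps))"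
    by (intro fps_agree_prod) (auto intro: fps_agree_one_minus_X_power)
  also have "(\<Prod>m\<in>{1..N}. if d * m \<le> N then 1 - fps_X ^ (d * m) else (1 :: 'a fps))
      = (\<Prod>m\<in>{m\<in>{1..N}. d * m \<le> N}. 1 - fps_X ^ (d * m))"
    by (intro prod.mono_neutral_cong_right) auto
  also have "\<dots> = (\<Prod>m\<in>{m\<in>{1..N}. d dvd m}. 1 - fps_X ^ m)"
    by (rule prod.reindex_bij_witness[of _ "\<lambda>m. m div d" "\<lambda>m. d * m"])
       (use d in \<open>auto elim!: dvdE simp: Suc_le_eq intro: le_trans[of k "d * k" N for k]\<close>)
  also have "\<dots> = (\<Prod>m\<in>{1..N}. if d dvd m then 1 - fps_X ^ m else (1 :: 'a fps))"
    by (intro prod.mono_neutral_cong_left) auto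
  finally show ?thesis .
qed

text \<open>The exponent 3 - [2 | m] - [2k+1 | m] + [4k+2 | m] of 1 / (1 - q^m). As 2 and 2k+1 are
  coprime, inclusion-exclusion makes it 3 minus the indicator that one of them divides m.\<close>

definition colours :: "nat \<Rightarrow> nat \<Rightarrow> nat" where
  "colours k m = (if even m \<or> (2 * k + 1) dvd m then 2 else 3)"

text \<open>Over an arbitrary field, since nonnegativity of the coefficients is a statement over the
  reals and Cauchy's formula one over the complex numbers.\<close>

definition euler_prod :: "(nat \<Rightarrow> nat) \<Rightarrow> nat \<Rightarrow> 'a::field fps" where
  "euler_prod c N = (\<Prod>m\<in>{1..N}. inverse (1 - fps_X ^ m) ^ c m)"

lemma nth_0_one_minus_X_power: "m > 0 \<Longrightarrow> fps_nth (1 - fps_X ^ m :: 'a::comm_ring_1 fps) 0 = 1"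
  by (simp add: fps_X_power_nth)

text \<open>\<open>Delta\<close> truncates the product at its own index, whereas log-concavity
  compares three coefficients of a single function; hence a common length N.\<close>

lemma Delta_eq_euler_prod:
  assumes "n \<le> N"
  shows "Delta k n = fps_nth (euler_prod (colours k) N) n"
proof -
  define P where "P d M = (\<Prod>m\<in>{1..M}. 1 - fps_X ^ (d * m) :: real fps)" for d M
  define P' where "P' d M = (\<Prod>m\<in>{1..M}. if d dvd m then 1 - fps_X ^ m else (1 :: real fps))" for d M
  have PP': "d > 0 \<Longrightarrow> fps_agree M (P d M) (P' d M)" for d M
    unfolding P_def P'_def by (rule fps_agree_prod_one_minus_X_power)
  have P0: "d > 0 \<Longrightarrow> fps_nth (P d M) 0 = 1" for d M
    by (induction M) (auto simp: P_def nth_0_one_minus_X_power)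
  have Delta_prod: "(\<Prod>m\<in>{1..M}. Delta_factor k m) = P 2 M * P (2*k+1) M * inverse (P 1 M ^ 3 * P (4*k+2) M)" for M
  proof (induction M)
    case (Suc M)
    have P_Suc: "P d (Suc M) = P d M * (1 - fps_X ^ (d * Suc M))" for d
      by (simp add: P_def mult.commute)
    have "(\<Prod>m\<in>{1..Suc M}. Delta_factor k m) = (\<Prod>m\<in>{1..M}. Delta_factor k m) * Delta_factor k (Suc M)"
      by (simp add: mult.commute)
    also have "\<dots> = P 2 M * P (2*k+1) M * inverse (P 1 M ^ 3 * P (4*k+2) M) * Delta_factor k (Suc M)"
      by (simp only: Suc.IH)
    finally show ?case
      by (simp only: P_Suc Delta_factor_def fps_inverse_mult power_mult_distrib mult_ac mult_1)
  qed (simp add: P_def)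
  have colour: "(if 2 dvd m then 1 - fps_X ^ m else 1) * (if (2*k+1) dvd m then 1 - fps_X ^ m else 1)
      * inverse ((1 - fps_X ^ m) ^ 3 * (if (4*k+2) dvd m then 1 - fps_X ^ m else 1))
      = inverse (1 - fps_X ^ m :: real fps) ^ colours k m" if m: "m > 0" for m
  proof -
    define y where "y = (1 - fps_X ^ m :: real fps)"
    have yy: "y * inverse y = 1"
      using nth_0_one_minus_X_power[OF m, where 'a=real] by (simp add: y_def inverse_mult_eq_1')
    have "coprime 2 (2 * k + 1)" by simp
    then have dv: "(4*k+2) dvd m \<longleftrightarrow> 2 dvd m \<and> (2*k+1) dvd m"
      using divides_mult[of 2 m "2*k+1"] dvd_mult_left[of 2 "2*k+1" m] dvd_mult_right[of 2 "2*k+1" m]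
      by (auto simp: algebra_simps)
    have e: "y * inverse (y ^ 3) = inverse y ^ 2" "y * (y * inverse (y ^ 3 * y)) = inverse y ^ 2"
       "y * inverse y ^ 3 = inverse y ^ 2"
      using yy by (simp_all add: fps_inverse_mult fps_inverse_power power2_eq_square power3_eq_cube, (metis mult.assoc mult.commute mult.left_neutral)+)
    show ?thesis
      unfolding y_def[symmetric] colours_def dv
      using e by (auto simp: mult_ac fps_inverse_power)
  qed
  have "fps_agree M (\<Prod>m\<in>{1..M}. Delta_factor k m) (P' 2 M * P' (2*k+1) M * inverse (P' 1 M ^ 3 * P' (4*k+2) M))" for M
    unfolding Delta_prod using P0 by (intro fps_agree_mult fps_agree_inverse fps_agree_power PP') (auto simp: fps_nth_power_0 fps_mult_nth)
  also have "P' 2 M * P' (2*k+1) M * inverse (P' 1 M ^ 3 * P' (4*k+2) M) = euler_prod (colours k) M" for M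
  proof -
    have "P' 2 M * P' (2*k+1) M * inverse (P' 1 M ^ 3 * P' (4*k+2) M) =
      (\<Prod>m\<in>{1..M}. (if 2 dvd m then 1 - fps_X ^ m else 1) * (if (2*k+1) dvd m then 1 - fps_X ^ m else 1)
      * inverse ((1 - fps_X ^ m) ^ 3 * (if (4*k+2) dvd m then 1 - fps_X ^ m else 1)))"
    proof (induction M)
      case (Suc M)
      have P'_Suc: "P' d (Suc M) = P' d M * (if d dvd Suc M then 1 - fps_X ^ Suc M else 1)" for d
        by (simp add: P'_def mult.commute del: power_Suc)
      have 1: "(if 1 dvd Suc M then 1 - fps_X ^ Suc M else 1) = (1 - fps_X ^ Suc M :: real fps)"
        by simp
      have 2: "(\<Prod>m\<in>{1..Suc M}. f m) = (\<Prod>m\<in>{1..M}. f m) * f (Suc M)" for f :: "nat \<Rightarrow> real fps"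
        by (simp add: mult.commute)
      show ?case
        unfolding 2 Suc.IH[symmetric]
        by (simp only: P'_Suc 1 fps_inverse_mult power_mult_distrib mult_ac)
    qed (simp add: P'_def)
    then show ?thesis unfolding euler_prod_def
      using colour by (auto intro!: prod.cong)
  qed
  finally have A: "fps_agree M (\<Prod>m\<in>{1..M}. Delta_factor k m) (euler_prod (colours k) M)" for M .
  \<comment> \<open>Lengthening the product from n to N adds only factors that are 1 up to order
    n.\<close>
  have "fps_agree n (euler_prod (colours k) N) (euler_prod (colours k) n :: real fps)"
  proof -
    have "fps_agree n (euler_prod (colours k) N) (\<Prod>m\<in>{1..N}. if m \<le> n then inverse (1 - fps_X ^ m) ^ colours k m else (1 :: real fps))"
      unfolding euler_prod_def
    proof (intro fps_agree_prod)
      fix m assume m: "m \<in> {1..N}"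
      show "fps_agree n (inverse (1 - fps_X ^ m) ^ colours k m) (if m \<le> n then inverse (1 - fps_X ^ m) ^ colours k m else (1 :: real fps))"
      proof (cases "m \<le> n")
        case False
        then have "fps_agree n (inverse (1 - fps_X ^ m) ^ colours k m) (inverse 1 ^ colours k m :: real fps)"
          using m by (intro fps_agree_power fps_agree_inverse fps_agree_one_minus_X_power) (auto simp: fps_X_power_nth)
        with False show ?thesis by simp
      qed simp
    qed
    also have "(\<Prod>m\<in>{1..N}. if m \<le> n then inverse (1 - fps_X ^ m) ^ colours k m else (1 :: real fps)) = euler_prod (colours k) n"
      unfolding euler_prod_def using assms by (intro prod.mono_neutral_cong_right) auto
    finally show ?thesis .
  qed
  with A[of n] show ?thesis by (simp add: fps_agree_def Delta_def)
qed

section \<open>Nonnegativity of the coefficients\<close>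

lemma fps_inverse_one_minus_X_power_nth:
  assumes "m > 0"
  shows "inverse (1 - fps_X ^ m) = (Abs_fps (\<lambda>i. if m dvd i then 1 else 0) :: 'a::field fps)"
proof -
  have "(1 - fps_X ^ m) * Abs_fps (\<lambda>i. if m dvd i then 1 else 0) = (1 :: 'a fps)"
  proof (rule fps_ext)
    fix i
    have "m dvd i \<longleftrightarrow> m dvd (i - m)" if "m \<le> i" for i using that by (simp add: dvd_minus_self)
    moreover have "m dvd i \<longleftrightarrow> i = 0" if "i < m" for i using that nat_dvd_not_less by auto
    ultimately show "fps_nth ((1 - fps_X ^ m) * Abs_fps (\<lambda>i. if m dvd i then 1 else 0)) i = fps_nth (1 :: 'a fps) i"
      using assms by (auto simp: ring_distribs fps_X_power_mult_nth not_less)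
  qed
  then show ?thesis
    by (metis fps_inverse_unique)
qed

lemma fps_nonneg_mult:
  fixes f g :: "real fps"
  assumes "\<And>i. fps_nth f i \<ge> 0" "\<And>i. fps_nth g i \<ge> 0"
  shows "fps_nth (f * g) i \<ge> 0"
  using assms by (auto simp: fps_mult_nth intro!: sum_nonneg)

lemma fps_nonneg_power:
  fixes f :: "real fps"
  assumes "\<And>i. fps_nth f i \<ge> 0"
  shows "fps_nth (f ^ k) i \<ge> 0"
  using assms by (induction k arbitrary: i) (auto intro: fps_nonneg_mult)

lemma euler_prod_nonneg: "fps_nth (euler_prod c N :: real fps) i \<ge> 0"
  unfolding euler_prod_def
proof (induction N arbitrary: i)
  case (Suc N)
  then show ?case
    using fps_inverse_one_minus_X_power_nth[of "Suc N", where 'a = real]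
    by (simp del: power_Suc) (auto intro!: fps_nonneg_mult fps_nonneg_power)
qed simp

section \<open>Coefficients as integrals over a circle\<close>

definition fps_cplx :: "real fps \<Rightarrow> complex fps" where
  "fps_cplx f = Abs_fps (\<lambda>i. of_real (fps_nth f i))"

lemma fps_cplx_mult: "fps_cplx (f * g) = fps_cplx f * fps_cplx g"
  by (auto simp: fps_cplx_def fps_eq_iff fps_mult_nth)

lemma fps_cplx_1: "fps_cplx 1 = 1"
  by (auto simp: fps_cplx_def fps_eq_iff)

lemma fps_cplx_power: "fps_cplx (f ^ k) = fps_cplx f ^ k"
  by (induction k) (auto simp: fps_cplx_mult fps_cplx_1)

lemma fps_cplx_prod: "fps_cplx (\<Prod>m\<in>A. f m) = (\<Prod>m\<in>A. fps_cplx (f m))"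
  by (induction A rule: infinite_finite_induct) (auto simp: fps_cplx_mult fps_cplx_1)

text \<open>Over any field the inverse of 1 - X^m has coefficients 0 and 1. Hence the Taylor
  coefficients of the complex function are those of the real series.\<close>

lemma fps_cplx_euler_prod: "fps_cplx (euler_prod c N) = euler_prod c N"
  unfolding euler_prod_def fps_cplx_prod fps_cplx_power
  by (intro prod.cong refl arg_cong2[of _ _ _ _ "(^)"])
     (auto simp: fps_inverse_one_minus_X_power_nth fps_cplx_def fps_eq_iff)

definition euler_fun :: "(nat \<Rightarrow> nat) \<Rightarrow> nat \<Rightarrow> complex \<Rightarrow> complex" where
  "euler_fun c N z = (\<Prod>m\<in>{1..N}. inverse (1 - z ^ m) ^ c m)"

lemma euler_fun_expansion: "euler_fun c N has_fps_expansion euler_prod c N"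
  unfolding euler_fun_def[abs_def] euler_prod_def
  by (intro has_fps_expansion_prod has_fps_expansion_power has_fps_expansion_inverse fps_expansion_intros)
     (auto simp: fps_X_power_nth)

lemma norm_power_less_1: "norm (z::complex) < 1 \<Longrightarrow> m > 0 \<Longrightarrow> norm (z ^ m) < 1"
  by (simp add: norm_power power_less_one_iff)

lemma one_minus_power_ne_0: "norm (z::complex) < 1 \<Longrightarrow> m > 0 \<Longrightarrow> 1 - z ^ m \<noteq> 0"
  using norm_power_less_1[of z m] by auto

lemma euler_fun_holomorphic: "euler_fun c N holomorphic_on ball 0 1"
  unfolding euler_fun_def[abs_def]
  by (intro holomorphic_intros) (use one_minus_power_ne_0 in auto)

lemma euler_prod_coeff_integral:
  assumes r: "0 < r" "r < 1"
  shows "((\<lambda>\<theta>. Re (euler_fun c N (of_real r * cis \<theta>) * cis (- (real n * \<theta>)))) has_integral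
          (2 * pi * (fps_nth (euler_prod c N) n * r ^ n))) {0..2 * pi}"
proof -
  let ?f = "euler_fun c N"
  have hol: "?f holomorphic_on cball 0 r" using euler_fun_holomorphic
    by (rule holomorphic_on_subset) (use r in auto)
  have "((\<lambda>u. ?f u / (u - 0) ^ Suc n) has_contour_integral (2 * pi * \<i>) / fact n * (deriv ^^ n) ?f 0) (circlepath 0 r)"
    using r hol by (intro Cauchy_has_contour_integral_higher_derivative_circlepath)
      (auto intro!: holomorphic_on_imp_continuous_on holomorphic_on_subset[OF hol])
  moreover have "(deriv ^^ n) ?f 0 = of_real (fps_nth (euler_prod c N) n) * fact n"
  proof -
    have "fps_nth (euler_prod c N) n = (deriv ^^ n) ?f 0 / fact n"
      using fps_nth_fps_expansion[OF euler_fun_expansion] .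
    moreover have "fps_nth (euler_prod c N) n = complex_of_real (fps_nth (euler_prod c N) n)"
      by (subst fps_cplx_euler_prod[symmetric]) (simp add: fps_cplx_def)
    ultimately show ?thesis by (simp add: field_simps)
  qed
  ultimately have "((\<lambda>u. ?f u / u ^ Suc n) has_contour_integral (2 * pi * \<i>) * of_real (fps_nth (euler_prod c N) n)) (circlepath 0 r)"
    by (simp add: mult.assoc)
  then have "((\<lambda>\<theta>. ?f (0 + of_real r * cis \<theta>) / (0 + of_real r * cis \<theta>) ^ Suc n * r * \<i> * cis \<theta>)
      has_integral (2 * pi * \<i>) * of_real (fps_nth (euler_prod c N) n)) {0..2*pi}"
    unfolding circlepath_def using r by (subst (asm) has_contour_integral_part_circlepath_iff) (auto simp: mult_ac)
  \<comment> \<open>The weight r^n / i removes the i of 2 pi i as well as the factor i r^-n left by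
    the parametrisation of the circle.\<close>
  from has_integral_mult_right[OF this, of "of_real (r ^ n) / \<i>"]
  have "((\<lambda>\<theta>. ?f (of_real r * cis \<theta>) * cis (- (real n * \<theta>)))
      has_integral complex_of_real (2 * pi * (fps_nth (euler_prod c N) n * r ^ n))) {0..2*pi}"
  proof (rule has_integral_eq_rhs[OF has_integral_eq, rotated])
    fix \<theta>
    have "cis (- (real n * \<theta>)) = inverse (cis \<theta> ^ n)"
      by (simp only: Complex.DeMoivre cis_inverse)
    then show "complex_of_real (r ^ n) / \<i> * (?f (0 + of_real r * cis \<theta>) / (0 + of_real r * cis \<theta>) ^ Suc n * r * \<i> * cis \<theta>)
       = ?f (of_real r * cis \<theta>) * cis (- (real n * \<theta>))"
      using r by (simp add: power_mult_distrib field_simps)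
  qed (simp add: field_simps)
  from has_integral_Re[OF this] show ?thesis by simp
qed

section \<open>The logarithm of a single factor\<close>

text \<open>The drop of Re (z / (1 - z)) from z = x to z = x cis a, which is also the sum over m of
  x^m (1 - cos (m a)). The first form governs the derivative of the phase, the second the lower
  bounds for the decay.\<close>

definition deficit :: "real \<Rightarrow> real \<Rightarrow> real" where
  "deficit x a = x * (1 + x) * (1 - cos a) / ((1 - x) * ((1 - x)\<^sup>2 + 2 * x * (1 - cos a)))"

lemma norm_one_minus_rcis_sq:
  "(cmod (1 - of_real x * cis a))\<^sup>2 = (1 - x)\<^sup>2 + 2 * x * (1 - cos a)"
proof -
  have "(cmod (1 - of_real x * cis a))\<^sup>2 = (1 - x * cos a)\<^sup>2 + (x * sin a)\<^sup>2"
    by (simp add: cmod_power2)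
  also have "\<dots> = 1 - 2 * x * cos a + x\<^sup>2 * ((cos a)\<^sup>2 + (sin a)\<^sup>2)"
    by (simp add: power2_diff power_mult_distrib distrib_left del: sin_cos_squared_add sin_cos_squared_add2)
  finally show ?thesis by (simp add: power2_eq_square algebra_simps)
qed

lemma one_minus_cos_le: "1 - cos (a :: real) \<le> a\<^sup>2 / 2"
proof -
  have "1 - cos a = 2 * (sin (a / 2))\<^sup>2"
    using cos_double_sin[of "a / 2"] by simp
  also have "(sin (a / 2))\<^sup>2 \<le> (a / 2)\<^sup>2"
    using abs_sin_x_le_abs_x[of "a / 2"] by (simp only: abs_le_square_iff)
  finally show ?thesis by (simp add: power_divide)
qed

context
  fixes x :: real
  assumes x: "0 < x" "x < 1"
begin

lemma norm_one_minus_rcis_sq_ge: "(1 - x)\<^sup>2 \<le> (cmod (1 - of_real x * cis a))\<^sup>2"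
  using x by (simp add: norm_one_minus_rcis_sq)

lemma norm_one_minus_rcis_ge: "1 - x \<le> cmod (1 - of_real x * cis a)"
  by (rule power2_le_imp_le[OF norm_one_minus_rcis_sq_ge]) simp

lemma one_minus_rcis_nz: "1 - of_real x * cis a \<noteq> 0"
  using norm_one_minus_rcis_ge[of a] x by auto

lemma deficit_denom_pos: "(1 - x)\<^sup>2 + 2 * x * (1 - cos a) > 0"
proof -
  have "(1 - x)\<^sup>2 > 0" "2 * x * (1 - cos a) \<ge> 0" using x by simp_all
  then show ?thesis by linarith
qed

lemma Re_inverse_one_minus_rcis:
  "Re (1 / (1 - of_real x * cis a)) = 1 / (1 - x) - deficit x a"
proof -
  define d where "d = (1 - x)\<^sup>2 + 2 * x * (1 - cos a)"
  have d: "d > 0" using deficit_denom_pos by (simp add: d_def)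
  have x1: "1 - x > 0" using x by simp
  have "Re (1 / (1 - of_real x * cis a)) = (1 - x * cos a) / d"
    by (simp add: Re_divide' norm_one_minus_rcis_sq d_def) 
  also have "\<dots> = (d - x * (1 + x) * (1 - cos a)) / ((1 - x) * d)"
  proof -
    have "(1 - x) * (1 - x * cos a) = d - x * (1 + x) * (1 - cos a)"
      by (simp add: d_def power2_eq_square algebra_simps)
    then have "(d - x * (1 + x) * (1 - cos a)) / ((1 - x) * d) = ((1 - x) * (1 - x * cos a)) / ((1 - x) * d)"
      by simp
    then show ?thesis using x1 by simp
  qed
  also have "\<dots> = 1 / (1 - x) - deficit x a"
    using d x1 by (simp add: deficit_def d_def[symmetric] diff_divide_distrib)
  finally show ?thesis .
qed

lemma Re_rcis_div_one_minus:
  "Re (of_real x * cis a / (1 - of_real x * cis a)) = x / (1 - x) - deficit x a"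
proof -
  have "of_real x * cis a / (1 - of_real x * cis a) = 1 / (1 - of_real x * cis a) - 1"
    using one_minus_rcis_nz by (simp add: field_simps)
  then have "Re (of_real x * cis a / (1 - of_real x * cis a)) = 1 / (1 - x) - deficit x a - 1"
    by (simp add: Re_inverse_one_minus_rcis)
  then show ?thesis using x by (simp add: field_simps)
qed

lemma deficit_nonneg: "deficit x a \<ge> 0"
  using x deficit_denom_pos by (simp add: deficit_def)

lemma deficit_le: "deficit x a \<le> x * (1 + x) * a\<^sup>2 / (2 * (1 - x) ^ 3)"
proof -
  have "deficit x a \<le> x * (1 + x) * (a\<^sup>2 / 2) / ((1 - x) * (1 - x)\<^sup>2)"
    unfolding deficit_def using x one_minus_cos_le deficit_denom_pos
    by (intro frac_le mult_left_mono mult_pos_pos) auto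
  also have "\<dots> = x * (1 + x) * a\<^sup>2 / (2 * (1 - x) ^ 3)"
    by (simp add: power2_eq_square power3_eq_cube)
  finally show ?thesis .
qed

lemma ln_ratio_nonneg: "0 \<le> ln (cmod (1 - of_real x * cis a)) - ln (1 - x)"
proof -
  have "ln (1 - x) \<le> ln (cmod (1 - of_real x * cis a))"
    using norm_one_minus_rcis_ge[of a] x by (subst ln_le_cancel_iff) linarith+
  then show ?thesis by simp
qed

lemma ln_ratio_le:
  "ln (cmod (1 - of_real x * cis a)) - ln (1 - x) \<le> x * a\<^sup>2 / (2 * (1 - x)\<^sup>2)"
proof -
  define q where "q = cmod (1 - of_real x * cis a)"
  have q: "q > 0" using one_minus_rcis_nz by (simp add: q_def)
  have "2 * (ln q - ln (1 - x)) = ln (q\<^sup>2 / (1 - x)\<^sup>2)"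
    using q x by (simp add: ln_div ln_realpow)
  also have "q\<^sup>2 / (1 - x)\<^sup>2 = 1 + 2 * x * (1 - cos a) / (1 - x)\<^sup>2"
    using x by (simp add: q_def norm_one_minus_rcis_sq add_divide_distrib)
  also have "ln \<dots> \<le> 2 * x * (1 - cos a) / (1 - x)\<^sup>2"
    using x by (intro ln_add_one_self_le_self) auto
  also have "\<dots> \<le> 2 * x * (a\<^sup>2 / 2) / (1 - x)\<^sup>2"
    using x one_minus_cos_le by (intro divide_right_mono mult_left_mono) auto
  also have "\<dots> = 2 * (x * a\<^sup>2 / (2 * (1 - x)\<^sup>2))" by simp
  finally show ?thesis unfolding q_def by (rule mult_left_le_imp_le) simp
qed

text \<open>The full series of the logarithm makes this an equality, and all its terms are
  nonnegative, so any truncation bounds from below.\<close>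

lemma ln_ratio_ge:
  "(\<Sum>j=1..J. x ^ j * (1 - cos (real j * a)) / real j) \<le> ln (cmod (1 - of_real x * cis a)) - ln (1 - x)"
proof -
  have z: "(\<lambda>j. (-1) ^ Suc j / of_nat j * (- z) ^ j) sums ln (1 + (- z))" if "cmod z < 1" for z
    using that Ln_series[of "- z"] by simp
  have z': "(\<lambda>j. - (z ^ j / of_nat j)) sums ln (1 - z)" if "cmod z < 1" for z
  proof -
    have "(-1) ^ Suc j / of_nat j * (- z) ^ j = - (z ^ j / of_nat j)" for j
      by (simp add: power_minus' uminus_power_if)
    then show ?thesis using z[OF that] by (simp only:) simp
  qed
  have pow: "(of_real x * cis b) ^ j / of_nat j = of_real (x ^ j / real j) * cis (real j * b)" for b j
    by (simp add: power_mult_distrib Complex.DeMoivre)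
  have 0: "(\<lambda>j. - (x ^ j / real j * cos (real j * b))) sums ln (cmod (1 - of_real x * cis b))" for b
  proof -
    have "cmod (of_real x * cis b) < 1" using x by (simp add: norm_mult)
    from sums_Re[OF z'[OF this]] show ?thesis
      unfolding pow using one_minus_rcis_nz[of b] by simp
  qed
  have "cmod (1 - complex_of_real x) = 1 - x"
    using x norm_of_real[of "1 - x", where 'a = complex] by simp
  with 0[of 0] have 2: "(\<lambda>j. - (x ^ j / real j)) sums ln (1 - x)"
    by simp
  note 1 = 0[of a]
  have 3: "(\<lambda>j. x ^ j * (1 - cos (real j * a)) / real j) sums (ln (cmod (1 - of_real x * cis a)) - ln (1 - x))"
    using sums_diff[OF 1 2] by (simp add: diff_divide_distrib algebra_simps)
  have "(\<Sum>j=1..J. x ^ j * (1 - cos (real j * a)) / real j) \<le> (\<Sum>j. x ^ j * (1 - cos (real j * a)) / real j)"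
    using 3 x by (intro sum_le_suminf) (auto simp: sums_iff)
  then show ?thesis using 3 by (simp add: sums_iff)
qed

text \<open>The infinite sum over m equals the deficit; each missing term is at most 2 x^m, so
  cutting at N costs a geometric tail.\<close>

lemma sum_deficit_ge:
  "deficit x a - 2 * x ^ Suc N / (1 - x) \<le> (\<Sum>m=1..N. x ^ m * (1 - cos (real m * a)))"
proof -
  have nz: "norm (of_real x * cis a) < 1" using x by (simp add: norm_mult)
  have "(\<lambda>m. Re ((of_real x * cis a) ^ m)) sums Re (1 / (1 - of_real x * cis a))"
    by (intro sums_Re geometric_sums nz)
  then have 1: "(\<lambda>m. x ^ m * cos (real m * a)) sums (1 / (1 - x) - deficit x a)"
    by (simp add: Re_inverse_one_minus_rcis power_mult_distrib Complex.DeMoivre flip: of_real_power)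
  have g: "(\<lambda>m. x ^ m) sums (1 / (1 - x))"
    using x by (intro geometric_sums) auto
  have "(\<lambda>m. x ^ m * (1 - cos (real m * a))) sums deficit x a"
    using sums_diff[OF g 1] by (simp add: algebra_simps)
  then have t: "(\<lambda>m. x ^ (m + Suc N) * (1 - cos (real (m + Suc N) * a))) sums
       (deficit x a - (\<Sum>m<Suc N. x ^ m * (1 - cos (real m * a))))"
    by (rule sums_split_initial_segment)
  have "(\<lambda>m. 2 * x ^ Suc N * x ^ m) sums (2 * x ^ Suc N * (1 / (1 - x)))"
    by (intro sums_mult g)
  with t have "deficit x a - (\<Sum>m<Suc N. x ^ m * (1 - cos (real m * a))) \<le> 2 * x ^ Suc N * (1 / (1 - x))"
  proof (rule sums_le[rotated])
    fix m
    have c: "1 - cos (real (m + Suc N) * a) \<le> 2" using cos_ge_minus_one[of "real (m + Suc N) * a"] by linarith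
    show "x ^ (m + Suc N) * (1 - cos (real (m + Suc N) * a)) \<le> 2 * x ^ Suc N * x ^ m"
      using mult_left_mono[OF c, of "x ^ (m + Suc N)"] x by (simp add: power_add mult_ac)
  qed
  moreover have "(\<Sum>m<Suc N. x ^ m * (1 - cos (real m * a))) = (\<Sum>m=1..N. x ^ m * (1 - cos (real m * a)))"
    by (rule sum.mono_neutral_cong_right) (auto simp: Suc_le_eq)
  ultimately show ?thesis by simp
qed

end

section \<open>Lower bounds for the deficit at small and large angles\<close>

lemma one_minus_cos_ge: "a\<^sup>2 / 2 - a ^ 4 / 24 \<le> 1 - cos (a :: real)"
proof -
  obtain t where "cos a = (\<Sum>m<4. cos_coeff m * a ^ m) + cos (t + 1/2 * real 4 * pi) / fact 4 * a ^ 4"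
    using Maclaurin_cos_expansion[of a 4] by blast
  moreover have "cos (t + 1/2 * real 4 * pi) / fact 4 * a ^ 4 \<le> 1 / fact 4 * a ^ 4"
    by (intro mult_right_mono divide_right_mono) auto
  moreover have "{..<4::nat} = {0, 1, 2, 3}" by auto
  then have "(\<Sum>m<4. cos_coeff m * a ^ m) = 1 - a\<^sup>2 / 2"
    by (simp add: cos_coeff_def)
  ultimately show ?thesis by (simp add: fact_numeral)
qed

text \<open>The right side is coth (u/2). After clearing denominators the difference vanishes at 0
  and has derivative 1 - (1 + t) exp (-t) \<ge> 0.\<close>

lemma coth_half_ge:
  fixes u :: real
  assumes "u > 0"
  shows "2 / u \<le> (1 + exp (-u)) / (1 - exp (-u))"
proof -
  have "0 * (1 + exp (-0)) - 2 * (1 - exp (-0)) \<le> u * (1 + exp (-u)) - 2 * (1 - exp (-u))"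
  proof (rule DERIV_nonneg_imp_nondecreasing[of 0 u "\<lambda>u. u * (1 + exp (-u)) - 2 * (1 - exp (-u))"])
    fix t :: real assume t: "0 \<le> t"
    have "((\<lambda>u. u * (1 + exp (-u)) - 2 * (1 - exp (-u))) has_real_derivative 1 - (1 + t) * exp (-t)) (at t)"
      by (auto intro!: derivative_eq_intros simp: algebra_simps)
    moreover have "(1 + t) * exp (-t) \<le> exp t * exp (-t)"
      by (intro mult_right_mono) auto
    ultimately show "\<exists>y. ((\<lambda>u. u * (1 + exp (-u)) - 2 * (1 - exp (-u))) has_real_derivative y) (at t) \<and> 0 \<le> y"
      by (auto simp: exp_minus_inverse)
  qed (use assms in auto)
  moreover have "1 - exp (-u) > 0" using assms by simp
  ultimately show ?thesis using assms by (simp add: field_simps)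
qed

text \<open>Splits off coth (u/2) and leaves a quotient that increases with 1 - cos a and decreases
  with cosh u, so that the three can be estimated separately.\<close>

lemma deficit_exp_eq:
  fixes u :: real
  assumes "u > 0"
  shows "deficit (exp (-u)) a = (1 + exp (-u)) / (1 - exp (-u)) * ((1 - cos a) / ((2 * cosh u - 2) + 2 * (1 - cos a)))"
proof -
  define R where "R = exp (-u)"
  have R: "R > 0" "R < 1" using assms by (auto simp: R_def)
  have "(1 - R)\<^sup>2 = R * (2 * cosh u - 2)"
    using exp_neg_ratio[of u] R by (simp add: R_def field_simps)
  then have e: "(1 - R)\<^sup>2 + 2 * R * (1 - cos a) = R * ((2 * cosh u - 2) + 2 * (1 - cos a))"
    by (simp add: algebra_simps)
  have "deficit R a = (R * ((1 + R) * (1 - cos a))) / (R * ((1 - R) * ((2 * cosh u - 2) + 2 * (1 - cos a))))"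
    unfolding deficit_def e by (simp only: mult_ac)
  also have "\<dots> = ((1 + R) * (1 - cos a)) / ((1 - R) * ((2 * cosh u - 2) + 2 * (1 - cos a)))"
    using R by (intro mult_divide_mult_cancel_left) auto
  finally show ?thesis by (simp add: R_def)
qed

lemma divide_le_divide_cross:
  fixes a b c d :: real
  assumes "a * d \<le> c * b" "b > 0" "d > 0"
  shows "a / b \<le> c / d"
  using assms by (simp add: pos_divide_le_eq pos_le_divide_eq)

lemma divide_add_double_mono:
  fixes c c' h h' :: real
  assumes "0 < c'" "c' \<le> c" "0 < h" "h \<le> h'"
  shows "c' / (h' + 2 * c') \<le> c / (h + 2 * c)"
proof -
  have "c' * h \<le> c * h'" using assms by (intro mult_mono) auto
  then have "c' * (h + 2 * c) \<le> c * (h' + 2 * c')" by (simp add: algebra_simps)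
  then show ?thesis using assms by (simp add: pos_divide_le_eq pos_le_divide_eq)
qed

text \<open>Odd terms cancel in exp u + exp (-u), and the two remainders with coefficient 2/6! give
  1/180. The range covers j s for j \<le> 4 and s \<le> 0.0969.\<close>

lemma cosh_bound:
  fixes u :: real
  assumes "0 \<le> u" "u \<le> 2/5"
  shows "2 * cosh u - 2 \<le> u\<^sup>2 * (1 + u\<^sup>2 / 12 + u ^ 4 / 180)"
proof -
  have e: "exp v \<le> (\<Sum>m<6. v ^ m / fact m) + 2 / fact 6 * v ^ 6" if v: "\<bar>v\<bar> \<le> 2/5" for v :: real
  proof -
    obtain t where t: "\<bar>t\<bar> \<le> \<bar>v\<bar>" "exp v = (\<Sum>m<6. v ^ m / fact m) + exp t / fact 6 * v ^ 6"
      using Maclaurin_exp_le[of v 6] by blast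
    have "exp t \<le> exp \<bar>t\<bar>" by simp
    also have "\<dots> \<le> 1 + \<bar>t\<bar> + \<bar>t\<bar>\<^sup>2" using t(1) v by (intro exp_bound) auto
    also have "\<bar>t\<bar>\<^sup>2 \<le> (2/5)\<^sup>2" using t(1) v by (intro power_mono) auto
    also have "1 + \<bar>t\<bar> + (2/5)\<^sup>2 \<le> 2" using t(1) v by (simp add: power2_eq_square)
    finally have "exp t \<le> 2" by simp
    then have "exp t / fact 6 * v ^ 6 \<le> 2 / fact 6 * v ^ 6"
      by (intro mult_right_mono divide_right_mono) auto
    then show ?thesis using t(2) by simp
  qed
  have "2 * cosh u = exp u + exp (-u)" by (simp add: cosh_field_def)
  also have "\<dots> \<le> ((\<Sum>m<6. u ^ m / fact m) + 2 / fact 6 * u ^ 6) + ((\<Sum>m<6. (-u) ^ m / fact m) + 2 / fact 6 * (-u) ^ 6)"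
    using assms by (intro add_mono e) auto
  also have "\<dots> = 2 + u\<^sup>2 + u ^ 4 / 12 + u ^ 6 / 180"
  proof -
    have "{..<6::nat} = {0, 1, 2, 3, 4, 5}" by auto
    then show ?thesis by (simp add: fact_numeral)
  qed
  also have "\<dots> = 2 + u\<^sup>2 * (1 + u\<^sup>2 / 12 + u ^ 4 / 180)"
    by (simp add: algebra_simps flip: power_add)
  finally show ?thesis by simp
qed

text \<open>To leading order coth (u/2), 1 - cos v and 2 cosh u - 2 are 2/u, v^2/2 and u^2, which
  gives the Lorentzian v^2 / (u (u^2 + v^2)). The constants \<open>k\<close> and \<open>h\<close>
  bound the relative errors at the extreme argument 0.3876 = 4 * 0.0969, and 0.975 is k/h rounded
  down.\<close>

lemma deficit_ge_Lorentz:
  fixes u v :: real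
  assumes "0 < u" "u \<le> 0.3876" "0 < v" "v \<le> u"
  shows "0.975 / u * (v\<^sup>2 / (u\<^sup>2 + v\<^sup>2)) \<le> deficit (exp (-u)) v"
proof -
  define k h where "k = (1 - 0.3876\<^sup>2 / 12 :: real)" and "h = (1 + 0.3876\<^sup>2 / 12 + 0.3876 ^ 4 / 180 :: real)"
  have u2: "u\<^sup>2 \<le> 0.3876\<^sup>2" "u ^ 4 \<le> 0.3876 ^ 4" "v\<^sup>2 \<le> 0.3876\<^sup>2" using assms by (auto intro!: power_mono)
  have kp: "k > 0" by (simp add: k_def power2_eq_square)
  have "v\<^sup>2 * v\<^sup>2 \<le> v\<^sup>2 * 0.3876\<^sup>2" using u2 by (intro mult_left_mono) auto
  then have c: "v\<^sup>2 / 2 * k \<le> 1 - cos v"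
    using one_minus_cos_ge[of v] by (simp add: k_def algebra_simps flip: power_add)
  have "2 * cosh u - 2 \<le> u\<^sup>2 * (1 + u\<^sup>2 / 12 + u ^ 4 / 180)"
    using assms by (intro cosh_bound) auto
  also have "\<dots> \<le> u\<^sup>2 * h" unfolding h_def using u2 by (intro mult_left_mono) auto
  finally have H: "2 * cosh u - 2 \<le> u\<^sup>2 * h" .
  have Hp: "2 * cosh u - 2 > 0" using cosh_real_strict_mono[of 0 u] assms by simp
  have kh: "0.975 * h \<le> k" "0.975 * k \<le> k" "h > 0" by (simp_all add: k_def h_def power2_eq_square power4_eq_xxxx)
  have "0.975 / u * (v\<^sup>2 / (u\<^sup>2 + v\<^sup>2)) = 2 / u * (0.975 * (v\<^sup>2 / 2) / (u\<^sup>2 + v\<^sup>2))"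
  proof -
    have 1: "a * (b / 2) / z = a / 2 * (b / z)" for a b z :: real by simp
    have 2: "a / u * X = 2 / u * (a / 2 * X)" for a X by simp
    show ?thesis unfolding 1 by (rule 2)
  qed
  also have "\<dots> \<le> 2 / u * ((v\<^sup>2 / 2 * k) / (u\<^sup>2 * h + 2 * (v\<^sup>2 / 2 * k)))"
  proof (intro mult_left_mono)
    have "0.975 * (u\<^sup>2 * h + v\<^sup>2 * k) \<le> u\<^sup>2 * k + v\<^sup>2 * k"
      using mult_left_mono[OF kh(1), of "u\<^sup>2"] mult_left_mono[OF kh(2), of "v\<^sup>2"] by (simp add: algebra_simps)
    from mult_left_mono[OF this, of "v\<^sup>2 / 2"]
    have "(0.975 * (v\<^sup>2 / 2)) * (u\<^sup>2 * h + 2 * (v\<^sup>2 / 2 * k)) \<le> (v\<^sup>2 / 2 * k) * (u\<^sup>2 + v\<^sup>2)"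
      by (simp add: algebra_simps)
    moreover have "u\<^sup>2 + v\<^sup>2 > 0" "u\<^sup>2 * h + 2 * (v\<^sup>2 / 2 * k) > 0"
      using assms kh kp by (auto intro!: add_pos_pos)
    ultimately show "0.975 * (v\<^sup>2 / 2) / (u\<^sup>2 + v\<^sup>2) \<le> (v\<^sup>2 / 2 * k) / (u\<^sup>2 * h + 2 * (v\<^sup>2 / 2 * k))"
      by (rule divide_le_divide_cross)
  qed (use assms in auto)
  also have "\<dots> \<le> 2 / u * ((1 - cos v) / ((2 * cosh u - 2) + 2 * (1 - cos v)))"
    using assms kp by (intro mult_left_mono divide_add_double_mono c H Hp) auto
  also have "\<dots> \<le> deficit (exp (-u)) v"
    unfolding deficit_exp_eq[OF assms(1)] using Hp assms(1) by (intro mult_right_mono coth_half_ge divide_nonneg_nonneg add_nonneg_nonneg) auto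
  finally show ?thesis .
qed

lemma deficit_mono:
  fixes u v w :: real
  assumes "0 < u" "0 < v" "v \<le> w" "w \<le> pi"
  shows "deficit (exp (-u)) v \<le> deficit (exp (-u)) w"
proof -
  have Hp: "2 * cosh u - 2 > 0" using cosh_real_strict_mono[of 0 u] assms by simp
  have "cos w \<le> cos v" using assms by (intro cos_monotone_0_pi_le) auto
  moreover have "cos v < 1" using cos_monotone_0_pi[of 0 v] assms by simp
  ultimately have "(1 - cos v) / ((2 * cosh u - 2) + 2 * (1 - cos v)) \<le> (1 - cos w) / ((2 * cosh u - 2) + 2 * (1 - cos w))"
    using Hp by (intro divide_add_double_mono) auto
  then show ?thesis
    unfolding deficit_exp_eq[OF assms(1)] using assms by (intro mult_left_mono) auto
qed

text \<open>By monotonicity it suffices to take v = 5 u, where the Lorentzian gives 25/26 of 1/u;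
  0.955 leaves room for the Taylor errors.\<close>

lemma deficit_ge_far:
  fixes u v :: real
  assumes "0 < u" "u \<le> 0.0969" "5 * u \<le> v" "v \<le> pi"
  shows "0.955 / u \<le> deficit (exp (-u)) v"
proof -
  define w where "w = 5 * u"
  have w: "0 < w" "w \<le> 0.4845" using assms by (auto simp: w_def)
  have Hp: "2 * cosh u - 2 > 0" using cosh_real_strict_mono[of 0 u] assms by simp
  have u2: "u\<^sup>2 \<le> 0.0969\<^sup>2" "u ^ 4 \<le> 0.0969 ^ 4" using assms by (auto intro!: power_mono)
  have "u\<^sup>2 / 12 + u ^ 4 / 180 \<le> 0.001"
    using u2 by (simp add: power2_eq_square power4_eq_xxxx)
  then have "u\<^sup>2 * (1 + u\<^sup>2 / 12 + u ^ 4 / 180) \<le> u\<^sup>2 * 1.001"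
    by (intro mult_left_mono) auto
  moreover have "2 * cosh u - 2 \<le> u\<^sup>2 * (1 + u\<^sup>2 / 12 + u ^ 4 / 180)"
    using assms by (intro cosh_bound) auto
  ultimately have H: "2 * cosh u - 2 \<le> u\<^sup>2 * 1.001" by linarith
  have "w ^ 4 = 625 * (u\<^sup>2 * u\<^sup>2)" by (simp add: w_def power_mult_distrib flip: power_add)
  moreover have "u\<^sup>2 \<le> 94/10000" using u2(1) by (simp add: power2_eq_square)
  then have "u\<^sup>2 * u\<^sup>2 \<le> u\<^sup>2 * (94/10000)" by (intro mult_left_mono) auto
  moreover have "w\<^sup>2 = 25 * u\<^sup>2" by (simp add: w_def power_mult_distrib)
  ultimately have "(1224/100) * u\<^sup>2 \<le> 1 - cos w"
    using one_minus_cos_ge[of w] zero_le_power2[of u] by linarith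
  then have c: "12.24 * u\<^sup>2 \<le> 1 - cos w" by simp
  have "0.955 / u = 2 / u * (0.4775 * u\<^sup>2 / u\<^sup>2)" using assms by simp
  also have "\<dots> \<le> 2 / u * ((12.24 * u\<^sup>2) / (u\<^sup>2 * 1.001 + 2 * (12.24 * u\<^sup>2)))"
    using assms by (intro mult_left_mono) (auto simp: field_simps)
  also have "\<dots> \<le> 2 / u * ((1 - cos w) / ((2 * cosh u - 2) + 2 * (1 - cos w)))"
    using assms by (intro mult_left_mono divide_add_double_mono c H Hp) auto
  also have "\<dots> \<le> deficit (exp (-u)) w"
    unfolding deficit_exp_eq[OF assms(1)] using Hp assms(1) by (intro mult_right_mono coth_half_ge divide_nonneg_nonneg add_nonneg_nonneg) auto
  also have "\<dots> \<le> deficit (exp (-u)) v"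
    using assms by (intro deficit_mono) (auto simp: w_def)
  finally show ?thesis .
qed

section \<open>Modulus and phase of the product\<close>

definition decay :: "(nat \<Rightarrow> nat) \<Rightarrow> nat \<Rightarrow> real \<Rightarrow> real \<Rightarrow> real" where
  "decay c N r \<theta> = (\<Sum>m=1..N. real (c m) *
     (ln (cmod (1 - of_real (r ^ m) * cis (real m * \<theta>))) - ln (1 - r ^ m)))"

text \<open>Each 1 - z with |z| < 1 lies in the right half-plane, so summing principal logarithms
  factor by factor gives a smooth branch of the argument, although the total may leave (-pi,
  pi].\<close>

definition phase :: "(nat \<Rightarrow> nat) \<Rightarrow> nat \<Rightarrow> nat \<Rightarrow> real \<Rightarrow> real \<Rightarrow> real" where
  "phase c N n r \<theta> = - (\<Sum>m=1..N. real (c m) *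
     Im (Ln (1 - of_real (r ^ m) * cis (real m * \<theta>)))) - real n * \<theta>"

lemma euler_fun_polar:
  assumes r: "0 < r" "r < 1"
  shows "Re (euler_fun c N (of_real r * cis \<theta>) * cis (- (real n * \<theta>))) =
    exp (- (\<Sum>m=1..N. real (c m) * ln (1 - r ^ m))) * (exp (- decay c N r \<theta>) * cos (phase c N n r \<theta>))"
proof -
  define z where "z m = of_real (r ^ m) * cis (real m * \<theta>)" for m
  define W where "W = (\<Sum>m=1..N. of_nat (c m) * (- Ln (1 - z m))) + \<i> * of_real (- (real n * \<theta>))"
  have nz: "1 - z m \<noteq> 0" if "m \<in> {1..N}" for m
    unfolding z_def using that r by (intro one_minus_rcis_nz) (auto simp: power_less_one_iff)
  have "euler_fun c N (of_real r * cis \<theta>) = (\<Prod>m=1..N. inverse (1 - z m) ^ c m)"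
    by (simp add: euler_fun_def z_def power_mult_distrib Complex.DeMoivre)
  also have "\<dots> = (\<Prod>m=1..N. exp (of_nat (c m) * (- Ln (1 - z m))))"
    using nz by (intro prod.cong refl) (simp add: exp_of_nat_mult exp_minus power_inverse del: mult_minus_right)
  also have "\<dots> * cis (- (real n * \<theta>)) = exp W"
    by (simp only: W_def exp_add exp_sum[OF finite_atLeastAtMost] cis_conv_exp)
  also have "Re (exp W) = exp (Re W) * cos (Im W)" by (simp add: Re_exp)
  also have "Im W = phase c N n r \<theta>"
    by (simp add: W_def phase_def z_def Im_sum sum_negf)
  also have "Re W = - decay c N r \<theta> - (\<Sum>m=1..N. real (c m) * ln (1 - r ^ m))"
    using nz by (simp add: W_def decay_def z_def sum_negf right_diff_distrib sum_subtractf)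
  finally show ?thesis by (simp add: exp_diff exp_minus field_simps)
qed

lemma phase_0 [simp]: assumes "0 < r" "r < 1" shows "phase c N n r 0 = 0"
proof -
  have "Im (Ln (1 - complex_of_real (r ^ m))) = 0" if "m \<in> {1..N}" for m
  proof -
    have "r ^ m < 1" using that assms by (auto simp: power_less_one_iff)
    then show ?thesis using Ln_of_real[of "1 - r ^ m"] by simp
  qed
  then show ?thesis by (simp add: phase_def)
qed

lemma has_real_derivative_Im_Ln:
  assumes x: "0 < x" "x < 1"
  shows "((\<lambda>t. Im (Ln (1 - of_real x * cis (b * t)))) has_real_derivative
           - (b * (x / (1 - x) - deficit x (b * t)))) (at t)"
proof -
  define z where "z = of_real x * cis (b * t)"
  have "Re z \<le> cmod z" by (rule complex_Re_le_cmod)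
  also have "\<dots> < 1" using x by (simp add: z_def norm_mult)
  finally have "1 - z \<notin> \<real>\<^sub>\<le>\<^sub>0" by (auto simp: complex_nonpos_Reals_iff)
  then have "((\<lambda>w. Ln (1 - of_real x * exp (\<i> * (of_real b * w)))) has_field_derivative
      (- (\<i> * of_real b * (z / (1 - z))))) (at (of_real t))"
    by (auto intro!: derivative_eq_intros simp: z_def cis_conv_exp divide_simps)
  then have "((\<lambda>t. Ln (1 - of_real x * cis (b * t))) has_vector_derivative (- (\<i> * of_real b * (z / (1 - z))))) (at t)"
    using has_vector_derivative_real_field by (fastforce simp: cis_conv_exp)
  from bounded_linear.has_vector_derivative[OF bounded_linear_Im this]
  have "((\<lambda>t. Im (Ln (1 - of_real x * cis (b * t)))) has_vector_derivative
      Im (- (\<i> * of_real b * (z / (1 - z))))) (at t)" .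
  moreover have "Im (- (\<i> * of_real b * w)) = - (b * Re w)" for w
    by simp
  ultimately show ?thesis
    unfolding has_real_derivative_iff_has_vector_derivative
    by (simp only: Re_rcis_div_one_minus[OF x] z_def)
qed

text \<open>\<open>mean\<close> is the saddle point equation: it makes r^-n F(r) stationary and so
  removes the linear term of the phase. In \<open>tail\<close>, 16 = 2 * 4 * 2 counts the lower
  bound for the colours, the four terms kept of the logarithm, and the factor 2 in the error of
  \<open>sum_deficit_ge\<close>.\<close>

locale saddle =
  fixes c :: "nat \<Rightarrow> nat" and N n :: nat and s r :: real
  assumes s_pos: "s > 0" and r_exp: "r = exp (-s)"
    and c_bounds: "\<And>m. 2 \<le> c m" "\<And>m. c m \<le> 3"
    and mean: "(\<Sum>m=1..N. real (c m) * (real m * (r ^ m / (1 - r ^ m)))) = real n"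
    and n_ge: "n \<ge> 526"
    and tail: "16 * r ^ Suc N / (1 - r) \<le> 1 / 100"
begin

lemmas r01 = r_bounds[OF s_pos r_exp]
lemmas rm01 = r_pow_bounds[OF s_pos r_exp]

lemma weighted_sum_le:
  assumes "\<And>m. m \<in> {1..N} \<Longrightarrow> 0 \<le> f m"
  shows "(\<Sum>m=1..N. real (c m) * f m) \<le> 3 * (\<Sum>m=1..N. f m)"
  unfolding sum_distrib_left using c_bounds assms by (intro sum_mono mult_right_mono) auto

lemma s_le: "s \<le> 0.0969"
proof -
  have "real n \<le> 3 * (\<Sum>m=1..N. real m * (r ^ m / (1 - r ^ m)))"
    unfolding mean[symmetric] using rm01 by (intro weighted_sum_le mult_nonneg_nonneg divide_nonneg_nonneg) (auto intro: less_imp_le)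
  also have "\<dots> \<le> 3 * (pi\<^sup>2 / (6 * s\<^sup>2))"
    using mean_sum_le[OF s_pos r_exp] by (intro mult_left_mono) auto
  finally have "real n * s\<^sup>2 \<le> pi\<^sup>2 / 2"
    using s_pos by (simp add: field_simps)
  moreover have "526 * s\<^sup>2 \<le> real n * s\<^sup>2" using n_ge by (intro mult_right_mono) auto
  moreover have "pi\<^sup>2 \<le> 3.14160\<^sup>2" using pi_approx by (intro power_mono) auto
  ultimately have "s\<^sup>2 \<le> 0.0969\<^sup>2" by (simp add: power2_eq_square)
  then show ?thesis by (rule power2_le_imp_le) simp
qed

lemma decay_le: "decay c N r \<theta> \<le> pi\<^sup>2 * \<theta>\<^sup>2 / (2 * s ^ 3)"
proof -
  have "decay c N r \<theta> \<le> 3 * (\<Sum>m=1..N. ln (cmod (1 - of_real (r ^ m) * cis (real m * \<theta>))) - ln (1 - r ^ m))"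
    unfolding decay_def using rm01 by (intro weighted_sum_le ln_ratio_nonneg) auto
  also have "\<dots> \<le> 3 * (\<Sum>m=1..N. r ^ m * (real m * \<theta>)\<^sup>2 / (2 * (1 - r ^ m)\<^sup>2))"
    using rm01 by (intro mult_left_mono sum_mono ln_ratio_le) auto
  also have "\<dots> = 3 * ((\<Sum>m=1..N. (real m)\<^sup>2 * (r ^ m / (1 - r ^ m)\<^sup>2)) * (\<theta>\<^sup>2 / 2))"
    unfolding sum_distrib_right by (simp add: power_mult_distrib mult_ac)
  also have "\<dots> \<le> 3 * (pi\<^sup>2 / (3 * s ^ 3) * (\<theta>\<^sup>2 / 2))"
    by (intro mult_left_mono mult_right_mono variance_sum_le[OF s_pos r_exp]) auto
  finally show ?thesis by (simp add: mult_ac)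
qed

text \<open>For fixed j the sum over m of the j-th terms of the logarithms is a truncated deficit at
  radius r^j and angle j \<theta>. The factor 2 is the least number of colours, and
  \<open>tail\<close> bounds the four truncation errors together by 1/100.\<close>

lemma decay_ge_deficits:
  "2 * (\<Sum>j=1..4. deficit (exp (- (real j * s))) (real j * \<theta>) / real j) - 1 / 100 \<le> decay c N r \<theta>"
proof -
  define L where "L m = ln (cmod (1 - of_real (r ^ m) * cis (real m * \<theta>))) - ln (1 - r ^ m)" for m
  have rj: "exp (- (real j * s)) = r ^ j" for j using r_pow[OF s_pos r_exp] by simp
  have t0: "r ^ Suc N / (1 - r) \<ge> 0" using r01 by simp
  have d: "deficit (r ^ j) (real j * \<theta>) / real j - 2 * (r ^ Suc N / (1 - r)) \<le>
      (\<Sum>m=1..N. (r ^ m) ^ j * (1 - cos (real j * (real m * \<theta>))) / real j)" if j: "j \<in> {1..4}" for j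
  proof -
    have rj1: "0 < r ^ j" "r ^ j < 1" using rm01 j by auto
    have "r ^ j \<le> r ^ 1" using j r01 by (intro power_decreasing) auto
    then have rr: "r ^ j \<le> r" by simp
    have "2 * (r ^ j) ^ Suc N / (1 - r ^ j) \<le> 2 * r ^ Suc N / (1 - r)"
      using rr rj1 r01 by (intro frac_le mult_left_mono power_mono) auto
    then have "deficit (r ^ j) (real j * \<theta>) - 2 * (r ^ Suc N / (1 - r)) \<le>
        (\<Sum>m=1..N. (r ^ j) ^ m * (1 - cos (real m * (real j * \<theta>))))"
      using sum_deficit_ge[OF rj1, of "real j * \<theta>" N] by simp
    from divide_right_mono[OF this, of "real j"]
    have "deficit (r ^ j) (real j * \<theta>) / real j - 2 * (r ^ Suc N / (1 - r)) / real j \<le>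
        (\<Sum>m=1..N. (r ^ j) ^ m * (1 - cos (real m * (real j * \<theta>))) / real j)"
      by (simp add: diff_divide_distrib sum_divide_distrib)
    moreover have "2 * (r ^ Suc N / (1 - r)) / real j \<le> 2 * (r ^ Suc N / (1 - r)) / 1"
      using j t0 by (intro divide_left_mono) auto
    moreover have "(\<Sum>m=1..N. (r ^ j) ^ m * (1 - cos (real m * (real j * \<theta>))) / real j) =
       (\<Sum>m=1..N. (r ^ m) ^ j * (1 - cos (real j * (real m * \<theta>))) / real j)"
      by (intro sum.cong refl) (simp only: power_swap[of r _ j] mult.left_commute)
    ultimately show ?thesis by linarith
  qed
  have "2 * (\<Sum>j=1..4. deficit (r ^ j) (real j * \<theta>) / real j) - 1 / 100
     \<le> 2 * (\<Sum>j=1..4. deficit (r ^ j) (real j * \<theta>) / real j - 2 * (r ^ Suc N / (1 - r)))"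
    using tail by (simp add: sum_subtractf)
  also have "\<dots> \<le> 2 * (\<Sum>j=1..4. \<Sum>m=1..N. (r ^ m) ^ j * (1 - cos (real j * (real m * \<theta>))) / real j)"
    using d by (intro mult_left_mono sum_mono) auto
  also have "\<dots> = (\<Sum>m=1..N. 2 * (\<Sum>j=1..4. (r ^ m) ^ j * (1 - cos (real j * (real m * \<theta>))) / real j))"
    by (subst sum.swap) (simp add: sum_distrib_left)
  also have "\<dots> \<le> (\<Sum>m=1..N. real (c m) * L m)"
  proof (intro sum_mono mult_mono)
    fix m assume m: "m \<in> {1..N}"
    show "(\<Sum>j=1..4. (r ^ m) ^ j * (1 - cos (real j * (real m * \<theta>))) / real j) \<le> L m"
      unfolding L_def using rm01[of m] m by (intro ln_ratio_ge) auto
    show "0 \<le> (\<Sum>j=1..4. (r ^ m) ^ j * (1 - cos (real j * (real m * \<theta>))) / real j)"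
      using r01 by (intro sum_nonneg) auto
    show "2 \<le> real (c m)" using c_bounds(1)[of m] by simp
  qed simp
  finally show ?thesis by (simp add: decay_def L_def rj)
qed

lemma sum_1_4: "(\<Sum>j=1..4. f j) = f 1 + f 2 + f 3 + f (4::nat)" for f :: "nat \<Rightarrow> real"
proof -
  have "{1..4::nat} = {1, 2, 3, 4}" by auto
  then show ?thesis by simp
qed

text \<open>The Lorentzian factor is unchanged when s and \<theta> are both scaled by j, so the four
  deficits add up to 2 * 0.975 * (1 + 1/4 + 1/9 + 1/16) > 2.776 times a common term.\<close>

lemma decay_ge_near:
  assumes "0 < \<theta>" "\<theta> \<le> s"
  shows "2.776 / s * (\<theta>\<^sup>2 / (s\<^sup>2 + \<theta>\<^sup>2)) - 1 / 100 \<le> decay c N r \<theta>"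
proof -
  define Y where "Y = \<theta>\<^sup>2 / (s\<^sup>2 + \<theta>\<^sup>2)"
  have Y: "Y \<ge> 0" by (simp add: Y_def)
  have d: "0.975 / s * Y / (real j)\<^sup>2 \<le> deficit (exp (- (real j * s))) (real j * \<theta>) / real j"
    if j: "j \<in> {1..4}" for j
  proof -
    have "real j * s \<le> 4 * 0.0969" using s_le j s_pos by (intro mult_mono) auto
    then have "0.975 / (real j * s) * ((real j * \<theta>)\<^sup>2 / ((real j * s)\<^sup>2 + (real j * \<theta>)\<^sup>2))
      \<le> deficit (exp (- (real j * s))) (real j * \<theta>)"
      using j assms s_pos by (intro deficit_ge_Lorentz) auto
    moreover have "(real j * \<theta>)\<^sup>2 / ((real j * s)\<^sup>2 + (real j * \<theta>)\<^sup>2) = Y"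
      using j by (simp add: Y_def power_mult_distrib flip: distrib_left)
    ultimately have "0.975 / (real j * s) * Y / real j \<le> deficit (exp (- (real j * s))) (real j * \<theta>) / real j"
      using j by (intro divide_right_mono) auto
    then show ?thesis using j by (simp add: power2_eq_square mult_ac)
  qed
  have "2.776 / s * Y \<le> 2 * (\<Sum>j=1..4. 0.975 / s * Y / (real j)\<^sup>2)"
  proof -
    define y where "y = Y / s"
    have "y \<ge> 0" using Y s_pos by (simp add: y_def)
    have e: "a / s * Y = a * y" for a by (simp add: y_def)
    show ?thesis unfolding sum_1_4 e using \<open>y \<ge> 0\<close> by simp
  qed
  also have "\<dots> \<le> 2 * (\<Sum>j=1..4. deficit (exp (- (real j * s))) (real j * \<theta>) / real j)"
    using d by (intro mult_left_mono sum_mono) auto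
  finally show ?thesis using decay_ge_deficits[of \<theta>] by (simp add: Y_def)
qed

text \<open>Monotonicity reduces to \<theta> = s, where the Lorentzian factor is 1/2, whence 1.388 =
  2.776 / 2. The limit 5 s keeps all angles j \<theta> below pi, where the deficit is
  monotone.\<close>

lemma decay_ge_middle:
  assumes "s \<le> \<theta>" "\<theta> \<le> 5 * s"
  shows "1.388 / s - 1 / 100 \<le> decay c N r \<theta>"
proof -
  have d: "0.4875 / s / (real j)\<^sup>2 \<le> deficit (exp (- (real j * s))) (real j * \<theta>) / real j"
    if j: "j \<in> {1..4}" for j
  proof -
    have "real j * s \<le> 4 * 0.0969" using s_le j s_pos by (intro mult_mono) auto
    then have 1: "0.975 / (real j * s) * ((real j * s)\<^sup>2 / ((real j * s)\<^sup>2 + (real j * s)\<^sup>2))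
      \<le> deficit (exp (- (real j * s))) (real j * s)"
      using j assms s_pos by (intro deficit_ge_Lorentz) auto
    have "b / (b + b) = 1 / 2" if "b \<noteq> 0" for b :: real
      using that by simp
    then have 2: "(real j * s)\<^sup>2 / ((real j * s)\<^sup>2 + (real j * s)\<^sup>2) = 1 / 2"
      using j s_pos by simp
    have 3: "deficit (exp (- (real j * s))) (real j * s) \<le> deficit (exp (- (real j * s))) (real j * \<theta>)"
    proof (rule deficit_mono)
      have "real j * \<theta> \<le> 4 * (5 * 0.0969)" using s_le j s_pos assms by (intro mult_mono) auto
      then show "real j * \<theta> \<le> pi" using pi_gt3 by simp
    qed (use j s_pos assms in auto)
    have "0.975 / (real j * s) * (1 / 2) \<le> deficit (exp (- (real j * s))) (real j * \<theta>)"
      using order_trans[OF 1[unfolded 2] 3] .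
    then have "0.975 / (real j * s) * (1 / 2) / real j \<le> deficit (exp (- (real j * s))) (real j * \<theta>) / real j"
      using j by (intro divide_right_mono) auto
    then show ?thesis using j by (simp add: power2_eq_square mult_ac)
  qed
  have "1.388 / s \<le> 2 * (\<Sum>j=1..4. 0.4875 / s / (real j)\<^sup>2)"
  proof -
    define y where "y = 1 / s"
    have "y \<ge> 0" using s_pos by (simp add: y_def)
    have e: "a / s = a * y" for a by (simp add: y_def)
    show ?thesis unfolding sum_1_4 e using \<open>y \<ge> 0\<close> by simp
  qed
  also have "\<dots> \<le> 2 * (\<Sum>j=1..4. deficit (exp (- (real j * s))) (real j * \<theta>) / real j)"
    using d by (intro mult_left_mono sum_mono) auto
  finally show ?thesis using decay_ge_deficits[of \<theta>] by simp
qed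

text \<open>For j > 1 the angle j \<theta> may pass pi and even reach a multiple of 2 pi, so only j
  = 1 is kept.\<close>

lemma decay_ge_far:
  assumes "5 * s \<le> \<theta>" "\<theta> \<le> pi"
  shows "1.91 / s - 1 / 100 \<le> decay c N r \<theta>"
proof -
  have "2 * (0.955 / s) \<le> 2 * deficit (exp (-s)) \<theta>"
    using deficit_ge_far[OF s_pos s_le assms] by simp
  also have "\<dots> \<le> 2 * (\<Sum>j\<in>{1..4}. deficit (exp (- (real j * s))) (real j * \<theta>) / real j)"
  proof -
    have "deficit (exp (- (real 1 * s))) (real 1 * \<theta>) / real 1 \<le> (\<Sum>j\<in>{1..4}. deficit (exp (- (real j * s))) (real j * \<theta>) / real j)"
      using s_pos by (intro member_le_sum divide_nonneg_nonneg deficit_nonneg) auto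
    then show ?thesis by simp
  qed
  finally show ?thesis using decay_ge_deficits[of \<theta>] by simp
qed

text \<open>The saddle equation cancels n against the values of x / (1 - x) at angle 0, so that only
  the drops, of second order in \<theta>, remain.\<close>

lemma phase_has_derivative:
  "(phase c N n r has_real_derivative - (\<Sum>m=1..N. real (c m) * (real m * deficit (r ^ m) (real m * \<theta>)))) (at \<theta>)"
proof -
  have "((\<lambda>\<theta>. Im (Ln (1 - of_real (r ^ m) * cis (real m * \<theta>)))) has_real_derivative
           - (real m * (r ^ m / (1 - r ^ m) - deficit (r ^ m) (real m * \<theta>)))) (at \<theta>)" if "m \<in> {1..N}" for m
    using that rm01 by (intro has_real_derivative_Im_Ln) auto
  then have "(phase c N n r has_real_derivative
      - (\<Sum>m=1..N. real (c m) * - (real m * (r ^ m / (1 - r ^ m) - deficit (r ^ m) (real m * \<theta>)))) - real n * 1) (at \<theta>)"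
    unfolding phase_def[abs_def]
    by (intro DERIV_diff DERIV_minus DERIV_sum DERIV_cmult DERIV_ident)
  moreover have "- (\<Sum>m=1..N. real (c m) * - (real m * (r ^ m / (1 - r ^ m) - deficit (r ^ m) (real m * \<theta>)))) - real n * 1
     = - (\<Sum>m=1..N. real (c m) * (real m * deficit (r ^ m) (real m * \<theta>)))"
    unfolding mean[symmetric] by (simp add: sum_negf right_diff_distrib sum_subtractf)
  ultimately show ?thesis by simp
qed

text \<open>From 0 \<le> D \<le> 3 B \<theta>^2 the phase decreases while phase + B \<theta>^3
  increases, and both vanish at 0.\<close>

lemma phase_bound:
  assumes "\<theta> \<ge> 0"
  shows "\<bar>phase c N n r \<theta>\<bar> \<le> 31 * pi\<^sup>2 * \<theta> ^ 3 / (60 * s ^ 4)"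
proof -
  define D where "D \<theta> = (\<Sum>m=1..N. real (c m) * (real m * deficit (r ^ m) (real m * \<theta>)))" for \<theta>
  define B where "B = 31 * pi\<^sup>2 / (60 * s ^ 4)"
  have ph: "(phase c N n r has_real_derivative - D t) (at t)" for t
    unfolding D_def by (rule phase_has_derivative)
  have D0: "D t \<ge> 0" for t
    unfolding D_def using rm01 by (intro sum_nonneg mult_nonneg_nonneg deficit_nonneg) auto
  have D1: "D t \<le> 3 * t\<^sup>2 * B" for t
  proof -
    have "D t \<le> 3 * (\<Sum>m=1..N. real m * deficit (r ^ m) (real m * t))"
      unfolding D_def using rm01 by (intro weighted_sum_le mult_nonneg_nonneg deficit_nonneg) auto
    also have "\<dots> \<le> 3 * (\<Sum>m=1..N. real m * (r ^ m * (1 + r ^ m) * (real m * t)\<^sup>2 / (2 * (1 - r ^ m) ^ 3)))"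
      using rm01 by (intro mult_left_mono sum_mono deficit_le) auto
    also have "(\<Sum>m=1..N. real m * (r ^ m * (1 + r ^ m) * (real m * t)\<^sup>2 / (2 * (1 - r ^ m) ^ 3)))
        = (\<Sum>m=1..N. real m ^ 3 * (r ^ m * (1 + r ^ m) / (1 - r ^ m) ^ 3)) * (t\<^sup>2 / 2)"
      unfolding sum_distrib_right
      by (intro sum.cong refl) (simp add: power_mult_distrib power2_eq_square power3_eq_cube mult_ac)
    also have "3 * \<dots> = 3 * (\<Sum>m=1..N. real m ^ 3 * (r ^ m * (1 + r ^ m) / (1 - r ^ m) ^ 3)) * (t\<^sup>2 / 2)"
      by (simp only: mult.assoc)
    also have "\<dots> \<le> 3 * (31 * pi\<^sup>2 / (30 * s ^ 4)) * (t\<^sup>2 / 2)"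
      by (intro mult_right_mono mult_left_mono cumulant3_sum_le[OF s_pos r_exp]) auto
    also have "\<dots> = 3 * t\<^sup>2 * B" by (simp add: B_def)
    finally show ?thesis .
  qed
  have "phase c N n r 0 \<ge> phase c N n r \<theta>"
    using ph D0 by (intro DERIV_nonpos_imp_nonincreasing[OF assms]) force
  moreover have "B * 0 ^ 3 + phase c N n r 0 \<le> B * \<theta> ^ 3 + phase c N n r \<theta>"
  proof (rule DERIV_nonneg_imp_nondecreasing[OF assms])
    fix t
    have "((\<lambda>t. B * t ^ 3 + phase c N n r t) has_real_derivative B * (3 * t\<^sup>2) + - D t) (at t)"
      by (intro DERIV_add DERIV_cmult ph) (auto intro!: derivative_eq_intros)
    moreover have "0 \<le> B * (3 * t\<^sup>2) + - D t" using D1[of t] by (simp add: mult_ac)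
    ultimately show "\<exists>y. ((\<lambda>t. B * t ^ 3 + phase c N n r t) has_real_derivative y) (at t) \<and> 0 \<le> y" by blast
  qed
  ultimately show ?thesis using r01 by (simp add: B_def)
qed

end

section \<open>Comparison functions for the integral\<close>

lemma exp_ge_Taylor5:
  fixes x :: real
  shows "1 + x + x\<^sup>2 / 2 + x ^ 3 / 6 + x ^ 4 / 24 + x ^ 5 / 120 \<le> exp x"
proof -
  obtain t where "exp x = (\<Sum>m<6. x ^ m / fact m) + exp t / fact 6 * x ^ 6"
    using Maclaurin_exp_le[of x 6] by blast
  moreover have "exp t / fact 6 * x ^ 6 \<ge> 0" by simp
  moreover have "{..<6::nat} = {0, 1, 2, 3, 4, 5}" by auto
  then have "(\<Sum>m<6. x ^ m / fact m) = 1 + x + x\<^sup>2 / 2 + x ^ 3 / 6 + x ^ 4 / 24 + x ^ 5 / 120"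
    by (simp add: fact_numeral)
  ultimately show ?thesis by linarith
qed

text \<open>For numerical values of exp at large arguments: the Taylor polynomial is accurate at the
  small x and is then raised to a power. Negative x is allowed, the remainder being of even
  order.\<close>

lemma exp_ge_power:
  fixes x :: real
  assumes "0 \<le> q" "q \<le> 1 + x + x\<^sup>2 / 2 + x ^ 3 / 6 + x ^ 4 / 24 + x ^ 5 / 120"
  shows "q ^ k \<le> exp (real k * x)"
proof -
  have "q \<le> exp x" using exp_ge_Taylor5[of x] assms by linarith
  then have "q ^ k \<le> exp x ^ k" using assms by (intro power_mono) auto
  then show ?thesis by (simp add: exp_of_nat_mult)
qed

text \<open>exp (- a / t^2) t^-k increases as long as k t^2 \<le> 2 a. This trades exponentially
  small contributions for powers of t.\<close>

lemma exp_inverse_square_le: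
  fixes a t t0 :: real
  assumes t: "0 < t" "t \<le> t0" and a: "real k \<le> 2 * a / t0\<^sup>2"
  shows "exp (- a / t\<^sup>2) \<le> exp (- a / t0\<^sup>2) * (t / t0) ^ k"
proof -
  define x where "x = t0 / t"
  define d where "d = a / t0\<^sup>2"
  have x: "x \<ge> 1" using t by (simp add: x_def)
  have d: "real k \<le> 2 * d" "d \<ge> 0" using a of_nat_0_le_iff[of k] by (auto simp: d_def simp del: of_nat_0_le_iff)
  have "x \<le> exp (x - 1)" using exp_ge_add_one_self[of "x - 1"] by simp
  then have "x ^ k \<le> exp (x - 1) ^ k" using x by (intro power_mono) auto
  also have "\<dots> = exp (real k * (x - 1))" by (simp add: exp_of_nat_mult)
  also have "\<dots> \<le> exp (d * (x\<^sup>2 - 1))"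
  proof -
    have "real k * (x - 1) \<le> (2 * d) * (x - 1)" using d x by (intro mult_right_mono) auto
    also have "(2 * d) * (x - 1) \<le> d * (x\<^sup>2 - 1)"
    proof -
      have "d * (x\<^sup>2 - 1) - (2 * d) * (x - 1) = d * (x - 1)\<^sup>2" by (simp add: power2_eq_square algebra_simps)
      then show ?thesis using d by (metis diff_ge_0_iff_ge mult_nonneg_nonneg zero_le_power2)
    qed
    finally show ?thesis by simp
  qed
  finally have "exp (- (d * x\<^sup>2)) * x ^ k \<le> exp (- (d * x\<^sup>2)) * exp (d * (x\<^sup>2 - 1))"
    by (intro mult_left_mono) auto
  also have "\<dots> = exp (- d)" by (simp add: algebra_simps flip: exp_add)
  finally have "exp (- (d * x\<^sup>2)) \<le> exp (- d) / x ^ k"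
    using x by (simp add: pos_le_divide_eq)
  moreover have "d * x\<^sup>2 = a / t\<^sup>2" using t by (simp add: d_def x_def power_divide)
  moreover have "exp (- d) / x ^ k = exp (- d) * (t / t0) ^ k" by (simp add: x_def power_divide)
  ultimately show ?thesis by (simp add: d_def)
qed

lemma integral_ge_antiderivative:
  fixes f F F' :: "real \<Rightarrow> real"
  assumes "a \<le> b" "f integrable_on {a..b}"
    and "\<And>x. a \<le> x \<Longrightarrow> x \<le> b \<Longrightarrow> (F has_real_derivative F' x) (at x)"
    and "\<And>x. a \<le> x \<Longrightarrow> x \<le> b \<Longrightarrow> F' x \<le> f x"
  shows "F b - F a \<le> integral {a..b} f"
proof -
  have "(F' has_integral F b - F a) {a..b}"
    using assms(1,3) by (intro fundamental_theorem_of_calculus)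
      (auto intro: has_field_derivative_at_within simp flip: has_real_derivative_iff_has_vector_derivative)
  then show ?thesis
    using assms by (intro has_integral_le[OF _ integrable_integral]) auto
qed

definition main_poly :: "real \<Rightarrow> real" where
  "main_poly y = 0.3333 * y ^ 3 + 0.6579 * y ^ 5 + 0.9276 * y ^ 7 + 0.8772 * y ^ 9
     + 0.787 * y ^ 11 + 0.5975 * y ^ 13 + 0.3931 * y ^ 15"

text \<open>The coefficients are those of the power series solution of
  $Q' - 2 a y Q = y^2 - 1.26 y^8$ with $a = 4.935$, rounded down and truncated.\<close>

lemma main_poly_derivative:
  obtains M' where
    "((\<lambda>y. main_poly y * exp (- 4.935 * y\<^sup>2)) has_real_derivative M') (at y)"
    "y \<ge> 0 \<Longrightarrow> M' \<le> y\<^sup>2 * (1 - 1.26 * y ^ 6) * exp (- 4.935 * y\<^sup>2)"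
proof
  define Q' where "Q' = 0.9999 * y ^ 2 + 3.2895 * y ^ 4 + 6.4932 * y ^ 6 + 7.8948 * y ^ 8
     + 8.657 * y ^ 10 + 7.7675 * y ^ 12 + 5.8965 * y ^ 14"
  have Q: "(main_poly has_real_derivative Q') (at y)"
    unfolding main_poly_def[abs_def] Q'_def
    by (rule derivative_eq_intros refl | simp)+
  show "((\<lambda>y. main_poly y * exp (- 4.935 * y\<^sup>2)) has_real_derivative
      (Q' - 9.87 * y * main_poly y) * exp (- 4.935 * y\<^sup>2)) (at y)"
    by (auto intro!: derivative_eq_intros Q simp: algebra_simps)
  assume y: "y \<ge> 0"
  have "y\<^sup>2 * (1 - 1.26 * y ^ 6) - (Q' - 9.87 * y * main_poly y) =
     0.0001 * y ^ 2 + 0.000171 * y ^ 4 + 0.000273 * y ^ 6 + 0.000612 * y ^ 8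
     + 0.000964 * y ^ 10 + 0.00019 * y ^ 12 + 0.000825 * y ^ 14 + 3.879897 * y ^ 16"
    by (simp add: main_poly_def Q'_def algebra_simps power_numeral_reduce)
  also have "\<dots> \<ge> 0" using y by (intro add_nonneg_nonneg) auto
  finally show "(Q' - 9.87 * y * main_poly y) * exp (- 4.935 * y\<^sup>2)
      \<le> y\<^sup>2 * (1 - 1.26 * y ^ 6) * exp (- 4.935 * y\<^sup>2)"
    by (intro mult_right_mono) auto
qed

lemma main_poly_value: "0.034 \<le> main_poly 0.8 * exp (- 4.935 * 0.8\<^sup>2)"
proof -
  have "0.6738 ^ 8 \<le> exp (real 8 * (- 0.3948 :: real))"
    by (rule exp_ge_power) (simp_all add: power_numeral_reduce)
  also have "real 8 * (- 0.3948) = - 4.935 * (0.8 :: real)\<^sup>2" by (simp add: power2_eq_square)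
  finally have e: "0.6738 ^ 8 \<le> exp (- 4.935 * (0.8 :: real)\<^sup>2)" .
  have "0.034 \<le> main_poly 0.8 * 0.6738 ^ 8"
    by (simp add: main_poly_def power_numeral_reduce)
  also have "\<dots> \<le> main_poly 0.8 * exp (- 4.935 * 0.8\<^sup>2)"
    using e by (intro mult_left_mono) (auto simp: main_poly_def)
  finally show ?thesis .
qed

text \<open>An approximate antiderivative of - y^2 exp (- E) with E = 2.76 y^2 / (1 + s y^2).
  Integration by parts suggests y^2 / E' = y (1 + s y^2)^2 / 5.52 as prefactor; enlarging 1/5.52 to
  0.2591, just above 1 / (5.52 - 1.66), absorbs the derivative of the prefactor.\<close>

definition tail_fun :: "real \<Rightarrow> real \<Rightarrow> real" where
  "tail_fun s y = 0.2591 * (y * (1 + s * y\<^sup>2)\<^sup>2) * exp (- (2.76 * y\<^sup>2 / (1 + s * y\<^sup>2)))"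

lemma tail_fun_derivative:
  assumes s: "0 < s" "s \<le> 0.0969" and y: "0.99 \<le> y" "s * y\<^sup>2 \<le> 1"
  obtains G' where "(tail_fun s has_real_derivative G') (at y)"
    "G' \<le> - (y\<^sup>2 * exp (- (2.76 * y\<^sup>2 / (1 + s * y\<^sup>2))))"
proof
  define w where "w = s * y\<^sup>2"
  define Y where "Y = y\<^sup>2"
  have w: "w > 0" "w \<le> 1" using s y by (auto simp: w_def)
  have nz: "1 + s * y\<^sup>2 \<noteq> 0" using w by (simp add: w_def)
  define p' where "p' = 0.2591 * ((1 + w) * (1 + 5 * w))"
  define E' where "E' = 5.52 * y / (1 + w)\<^sup>2"
  have p: "((\<lambda>y. 0.2591 * (y * (1 + s * y\<^sup>2)\<^sup>2)) has_real_derivative p') (at y)"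
    by (auto intro!: derivative_eq_intros simp: p'_def w_def power2_eq_square algebra_simps)
  have "((\<lambda>y. y\<^sup>2 / (1 + s * y\<^sup>2)) has_real_derivative
      (2 * y * (1 + s * y\<^sup>2) - y\<^sup>2 * (s * (2 * y))) / ((1 + s * y\<^sup>2) * (1 + s * y\<^sup>2))) (at y)"
    using nz by (auto intro!: derivative_eq_intros)
  moreover have "2 * y * (1 + s * y\<^sup>2) - y\<^sup>2 * (s * (2 * y)) = 2 * y"
    by (simp add: algebra_simps)
  ultimately have "((\<lambda>y. y\<^sup>2 / (1 + s * y\<^sup>2)) has_real_derivative 2 * y / (1 + w)\<^sup>2) (at y)"
    by (simp add: w_def power2_eq_square)
  from DERIV_cmult[OF this, of "- 2.76"]
  have E: "((\<lambda>y. - (2.76 * y\<^sup>2 / (1 + s * y\<^sup>2))) has_real_derivative - E') (at y)"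
    by (simp add: E'_def)
  show "(tail_fun s has_real_derivative
      (p' - 0.2591 * (y * (1 + w)\<^sup>2) * E') * exp (- (2.76 * y\<^sup>2 / (1 + s * y\<^sup>2)))) (at y)"
    unfolding tail_fun_def[abs_def]
    using DERIV_mult[OF p DERIV_fun_exp[OF E]] by (simp add: w_def algebra_simps)
  have cancel: "a * (y * q) * (b * y / q) = a * b * (y * y)" if "q \<noteq> 0" for a b q
    using that by simp
  have pE: "0.2591 * (y * (1 + w)\<^sup>2) * E' = 0.2591 * 5.52 * Y"
    unfolding E'_def Y_def power2_eq_square[of y] by (rule cancel) (use w in simp)
  \<comment> \<open>For fixed s, w runs from at least 0.9801 s to 1, so w^2 lies below its chord.
    The result is then compared at the largest s, through the product with 0.0969 - s.\<close>
  have "(1 + w) * (1 + 5 * w) \<le> 1.66 * Y"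
  proof -
    have Y: "Y \<ge> 0.9801" using power_mono[OF y(1), of 2] by (simp add: Y_def power2_eq_square)
    have "s * 0.9801 \<le> s * Y" using Y s by (intro mult_left_mono) auto
    then have "(w - s * 0.9801) * (1 - w) \<ge> 0"
      using w by (intro mult_nonneg_nonneg) (auto simp: w_def Y_def)
    then have "w * w \<le> w + 9801/10000 * (s * w) - 9801/10000 * s"
      by (simp add: algebra_simps diff_divide_distrib)
    moreover have "s * w \<le> 969/10000 * w" using s w by (intro mult_right_mono) auto
    ultimately have "1 + 6 * w + 5 * (w * w) \<le> 1 + 11475/1000 * w - 49005/10000 * s"
      using w by linarith
    also have "\<dots> \<le> 1.66 * Y"
    proof -
      have "0 \<le> (0.0969 - s) * (11.475 * Y - 4.9005)"
        using s Y by (intro mult_nonneg_nonneg) auto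
      moreover have "(0.0969 - s) * (11.475 * Y - 4.9005) = 1.1119275 * Y - 0.47485845 - 11.475 * (s * Y) + 4.9005 * s"
        by (simp add: algebra_simps)
      moreover have "w = s * Y" by (simp add: w_def Y_def)
      ultimately show ?thesis using Y by (simp add: field_simps)
    qed
    finally show ?thesis by (simp add: algebra_simps)
  qed
  moreover have "Y \<ge> 0" by (simp add: Y_def)
  ultimately have "p' - 0.2591 * (y * (1 + w)\<^sup>2) * E' \<le> - Y"
    unfolding pE p'_def by simp
  from mult_right_mono[OF this, of "exp (- (2.76 * y\<^sup>2 / (1 + s * y\<^sup>2)))"]
  show "(p' - 0.2591 * (y * (1 + w)\<^sup>2) * E') * exp (- (2.76 * y\<^sup>2 / (1 + s * y\<^sup>2)))
     \<le> - (y\<^sup>2 * exp (- (2.76 * y\<^sup>2 / (1 + s * y\<^sup>2))))"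
    by (simp add: Y_def)
qed

lemma tail_fun_value:
  assumes s: "0 < s" "s \<le> 0.0969"
  shows "tail_fun s 0.99 \<le> 0.0263"
proof -
  have y: "0.99\<^sup>2 = (0.9801 :: real)" by (simp add: power2_eq_square)
  have l: "1 + s * 0.9801 \<le> 1.095" using s by simp
  have "1.279 ^ 10 \<le> exp (real 10 * (0.247 :: real))"
    by (rule exp_ge_power) (simp_all add: power_numeral_reduce)
  then have "exp (- 2.47) \<le> inverse (1.279 ^ 10 :: real)"
    by (simp add: exp_minus le_imp_inverse_le)
  also have "\<dots> \<le> (0.0855 :: real)" by (simp add: power_numeral_reduce)
  finally have e: "exp (- 2.47) \<le> (0.0855 :: real)" .
  have "2.47 \<le> 2.76 * 0.9801 / (1.095 :: real)" by simp
  also have "\<dots> \<le> 2.76 * 0.9801 / (1 + s * 0.9801)"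
    using s l by (intro divide_left_mono mult_pos_pos) auto
  finally have "exp (- (2.76 * 0.9801 / (1 + s * 0.9801))) \<le> exp (- 2.47)" by simp
  also note e
  finally have e': "exp (- (2.76 * 0.9801 / (1 + s * 0.9801))) \<le> 0.0855" .
  have "(1 + s * 0.9801)\<^sup>2 \<le> 1.095\<^sup>2" using l s by (intro power_mono) auto
  then have "0.2591 * (0.99 * (1 + s * 0.9801)\<^sup>2) * exp (- (2.76 * 0.9801 / (1 + s * 0.9801)))
      \<le> 0.2591 * (0.99 * 1.095\<^sup>2) * 0.0855"
    using e' by (intro mult_mono) auto
  then have "tail_fun s 0.99 \<le> 0.2591 * (0.99 * 1.095\<^sup>2) * 0.0855"
    unfolding tail_fun_def y .
  also have "\<dots> \<le> 0.0263" by (simp add: power2_eq_square)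
  finally show ?thesis .
qed

section \<open>Positivity of the integral\<close>

context saddle
begin

text \<open>The natural width of the peak is s^(3/2) = t^3. With \<theta> = t^3 y the weight 1 - cos
  \<theta> contributes t^6 and d\<theta> contributes t^3, whence the common unit t^9.\<close>

definition t where "t = sqrt s"

definition integrand where "integrand \<theta> = exp (- decay c N r \<theta>) * cos (phase c N n r \<theta>) * (1 - cos \<theta>)"

lemma t_pos: "t > 0" and t_sq: "t\<^sup>2 = s" and t_le: "t \<le> 0.3113"
proof -
  show "t > 0" "t\<^sup>2 = s" using s_pos by (auto simp: t_def)
  have "t\<^sup>2 \<le> 0.3113\<^sup>2" using s_le by (simp add: t_def s_pos less_imp_le power2_eq_square)
  then show "t \<le> 0.3113" by (rule power2_le_imp_le) simp
qed

lemma t_cube: "t ^ 3 = s * t"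
  by (simp only: power3_eq_cube t_sq[unfolded power2_eq_square])

lemma t_6: "t ^ 6 = s ^ 3"
proof -
  have "t ^ 6 = (t\<^sup>2) ^ 3" by simp
  then show ?thesis by (simp only: t_sq)
qed

lemma pi_sq_le: "pi\<^sup>2 \<le> 9.8697"
proof -
  have "pi\<^sup>2 \<le> 3.1416\<^sup>2" using pi_approx by (intro power_mono) auto
  then show ?thesis by (simp add: power2_eq_square)
qed

lemma integrand_continuous: "continuous_on A integrand"
proof -
  have "continuous_on A (\<lambda>\<theta>. decay c N r \<theta>)"
  proof -
    have "1 - of_real (r ^ m) * cis (real m * \<theta>) \<noteq> 0" if "m \<in> {1..N}" for m \<theta>
      using rm01[of m] that by (intro one_minus_rcis_nz) auto
    then show ?thesis
      unfolding decay_def by (intro continuous_intros) auto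
  qed
  moreover have "continuous_on A (\<lambda>\<theta>. phase c N n r \<theta>)"
    by (intro continuous_at_imp_continuous_on ballI DERIV_isCont[OF phase_has_derivative])
  ultimately show ?thesis unfolding integrand_def[abs_def] by (intro continuous_intros)
qed

lemma integrand_integrable: "integrand integrable_on {a..b}"
  by (intro integrable_continuous_real integrand_continuous)

text \<open>In the scale \<theta> = t^3 y the phase bound is (31 pi^2 / 60) t y^3, evaluated at t =
  0.3113. The unrounded coefficient is kept for the square, since 1.5875^2 / 2 slightly exceeds
  1.26.\<close>

lemma phase_scaled:
  assumes "y \<ge> 0"
  shows "\<bar>phase c N n r (t ^ 3 * y)\<bar> \<le> 1.5875 * y ^ 3"
    and "(phase c N n r (t ^ 3 * y))\<^sup>2 / 2 \<le> 1.26 * y ^ 6"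
proof -
  have "\<bar>phase c N n r (t ^ 3 * y)\<bar> \<le> 31 * pi\<^sup>2 * (t ^ 3 * y) ^ 3 / (60 * (t\<^sup>2) ^ 4)"
    unfolding t_sq using assms t_pos by (intro phase_bound) auto
  also have "\<dots> = 31 * pi\<^sup>2 / 60 * t * y ^ 3 * ((t\<^sup>2) ^ 4 / (t\<^sup>2) ^ 4)"
    by (simp add: power_mult_distrib power_numeral_reduce)
  also have "\<dots> = (31 * pi\<^sup>2 / 60 * t) * y ^ 3" using t_pos by simp
  also have "\<dots> \<le> (31 * 9.8697 / 60 * 0.3113) * y ^ 3"
    using pi_sq_le t_le t_pos assms by (intro mult_right_mono mult_mono) auto
  finally have *: "\<bar>phase c N n r (t ^ 3 * y)\<bar> \<le> (31 * 9.8697 / 60 * 0.3113) * y ^ 3" .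
  also have "\<dots> \<le> 1.5875 * y ^ 3" using assms by (intro mult_right_mono) auto
  finally show "\<bar>phase c N n r (t ^ 3 * y)\<bar> \<le> 1.5875 * y ^ 3" .
  have "(phase c N n r (t ^ 3 * y))\<^sup>2 \<le> ((31 * 9.8697 / 60 * 0.3113) * y ^ 3)\<^sup>2"
    using * power_mono[OF *, of 2] by simp
  also have "\<dots> = (31 * 9.8697 / 60 * 0.3113)\<^sup>2 * y ^ 6"
    by (simp only: power_mult_distrib) simp
  also have "\<dots> \<le> 2.52 * y ^ 6" using assms by (intro mult_right_mono) (auto simp: power2_eq_square)
  finally show "(phase c N n r (t ^ 3 * y))\<^sup>2 / 2 \<le> 1.26 * y ^ 6" by simp
qed

text \<open>0.99 lies just below the point near 0.996 where 1.5875 y^3 reaches pi/2.\<close>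

lemma cos_phase_nonneg:
  assumes "0 \<le> y" "y \<le> 99/100"
  shows "0 \<le> cos (phase c N n r (t ^ 3 * y))"
proof (rule cos_ge_zero)
  have "y ^ 3 \<le> 0.99 ^ 3" using assms by (intro power_mono) auto
  then have "1.5875 * y ^ 3 \<le> 1.5875 * 0.99 ^ 3" by simp
  also have "\<dots> \<le> 3.14 / (2::real)" by (simp add: power3_eq_cube)
  also have "\<dots> \<le> pi / 2" using pi_approx by simp
  finally have "1.5875 * y ^ 3 \<le> pi / 2" .
  with phase_scaled(1)[OF assms(1)]
  have "\<bar>phase c N n r (t ^ 3 * y)\<bar> \<le> pi / 2" by linarith
  then show "- (pi / 2) \<le> phase c N n r (t ^ 3 * y)" "phase c N n r (t ^ 3 * y) \<le> pi / 2"
    by linarith+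
qed

lemma integrand_ge_main:
  assumes "0 \<le> y" "y \<le> 0.8"
  shows "0.49995 * t ^ 6 * (y\<^sup>2 * (1 - 1.26 * y ^ 6) * exp (- 4.935 * y\<^sup>2)) \<le> integrand (t ^ 3 * y)"
proof -
  have "decay c N r (t ^ 3 * y) \<le> pi\<^sup>2 * (t ^ 3 * y)\<^sup>2 / (2 * (t\<^sup>2) ^ 3)"
    unfolding t_sq by (rule decay_le)
  also have "\<dots> = pi\<^sup>2 / 2 * y\<^sup>2"
    using t_pos by (simp add: power_mult_distrib)
  also have "\<dots> \<le> 4.935 * y\<^sup>2" using pi_sq_le by (intro mult_right_mono) auto
  finally have 1: "exp (- 4.935 * y\<^sup>2) \<le> exp (- decay c N r (t ^ 3 * y))" by simp
  have "cos (phase c N n r (t ^ 3 * y)) \<ge> 1 - (phase c N n r (t ^ 3 * y))\<^sup>2 / 2"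
    using one_minus_cos_le[of "phase c N n r (t ^ 3 * y)"] by linarith
  then have 2: "1 - 1.26 * y ^ 6 \<le> cos (phase c N n r (t ^ 3 * y))"
    using phase_scaled(2)[OF assms(1)] by linarith
  have "y ^ 6 \<le> 0.8 ^ 6" using assms by (intro power_mono) auto
  then have cos_lb: "0 \<le> 1 - 1.26 * y ^ 6" by (simp add: power_numeral_reduce)
  define \<theta> where "\<theta> = t ^ 3 * y"
  \<comment> \<open>On this range \<theta> \<le> 0.03, so the quartic term of 1 - cos \<theta>
    lowers the factor 1/2 only to 0.49995.\<close>
  have "\<theta> \<le> 0.3113 ^ 3 * 0.8" unfolding \<theta>_def using t_pos t_le assms by (intro mult_mono power_mono) auto
  also have "\<dots> \<le> 0.03" by (simp add: power3_eq_cube)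
  finally have "\<theta>\<^sup>2 \<le> 0.03\<^sup>2" using t_pos assms by (intro power_mono) (auto simp: \<theta>_def)
  then have "\<theta>\<^sup>2 \<le> 0.0009" by (simp add: power2_eq_square)
  then have "\<theta>\<^sup>2 * \<theta>\<^sup>2 \<le> \<theta>\<^sup>2 * 0.0009" by (intro mult_left_mono) auto
  then have "\<theta> ^ 4 \<le> 9 / 10000 * \<theta>\<^sup>2" by (simp flip: power_add)
  then have "49995 / 100000 * \<theta>\<^sup>2 \<le> 1 - cos \<theta>"
    using one_minus_cos_ge[of \<theta>] zero_le_power2[of \<theta>] by linarith
  then have "0.49995 * \<theta>\<^sup>2 \<le> 1 - cos \<theta>" by simp
  moreover have "\<theta>\<^sup>2 = t ^ 6 * y\<^sup>2" by (simp add: \<theta>_def power_mult_distrib)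
  ultimately have 3: "0.49995 * (t ^ 6 * y\<^sup>2) \<le> 1 - cos (t ^ 3 * y)" by (simp add: \<theta>_def)
  have "exp (- 4.935 * y\<^sup>2) * (1 - 1.26 * y ^ 6) * (0.49995 * (t ^ 6 * y\<^sup>2)) \<le> integrand (t ^ 3 * y)"
    unfolding integrand_def using 1 2 cos_lb 3 cos_phase_nonneg[OF assms(1)] assms
    by (intro mult_mono mult_nonneg_nonneg) (auto simp: zero_le_even_power)
  then show ?thesis by (simp add: mult_ac)
qed

lemma integrand_ge_of_decay:
  assumes "b \<le> decay c N r \<theta>"
  shows "- (exp (- b) * (1 - cos \<theta>)) \<le> integrand \<theta>"
proof -
  have "exp (- decay c N r \<theta>) \<le> exp (- b)" using assms by simp
  moreover have "\<bar>integrand \<theta>\<bar> = exp (- decay c N r \<theta>) * \<bar>cos (phase c N n r \<theta>)\<bar> * (1 - cos \<theta>)"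
    by (simp add: integrand_def abs_mult)
  moreover have "\<dots> \<le> exp (- decay c N r \<theta>) * 1 * (1 - cos \<theta>)"
    by (intro mult_right_mono mult_left_mono) auto
  moreover have "exp (- decay c N r \<theta>) * 1 * (1 - cos \<theta>) \<le> exp (- b) * (1 - cos \<theta>)"
    using assms by (intro mult_right_mono) auto
  ultimately have "\<bar>integrand \<theta>\<bar> \<le> exp (- b) * (1 - cos \<theta>)" by linarith
  then show ?thesis by linarith
qed

text \<open>The condition s y^2 \<le> 1 says \<theta> \<le> s, the range of
  \<open>decay_ge_near\<close>, whose bound becomes 2.776 y^2 / (1 + s y^2) - 1/100 in the scaled
  variable.\<close>

lemma integrand_ge_tail:
  assumes "0.99 \<le> y" "s * y\<^sup>2 \<le> 1"
  shows "- (t ^ 6 / 2 * (y\<^sup>2 * exp (- (2.76 * y\<^sup>2 / (1 + s * y\<^sup>2))))) \<le> integrand (t ^ 3 * y)"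
proof -
  define \<theta> where "\<theta> = t ^ 3 * y"
  have th: "\<theta> > 0" using t_pos assms by (simp add: \<theta>_def)
  have th2: "\<theta>\<^sup>2 = s ^ 3 * y\<^sup>2" by (simp add: \<theta>_def power_mult_distrib t_6)
  have num: "s ^ 3 * y\<^sup>2 = s\<^sup>2 * (s * y\<^sup>2)"
    by (simp add: power3_eq_cube power2_eq_square)
  have "s\<^sup>2 * (s * y\<^sup>2) \<le> s\<^sup>2 * 1"
    using assms(2) by (intro mult_left_mono) auto
  then have "\<theta>\<^sup>2 \<le> s\<^sup>2" by (simp only: th2 num mult_1_right)
  then have ths: "\<theta> \<le> s" by (rule power2_le_imp_le) (use s_pos in simp)
  have Y: "0.98 \<le> y\<^sup>2" using power_mono[OF assms(1), of 2] by (simp add: power2_eq_square)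
  have pos: "1 + s * y\<^sup>2 > 0" using s_pos by (simp add: add_pos_nonneg)
  define X where "X = y\<^sup>2 / (1 + s * y\<^sup>2)"
  define V where "V = exp (- (2.76 * y\<^sup>2 / (1 + s * y\<^sup>2)))"
  have den: "s\<^sup>2 + s ^ 3 * y\<^sup>2 = s\<^sup>2 * (1 + s * y\<^sup>2)"
    by (simp only: num distrib_left mult_1_right)
  have "\<theta>\<^sup>2 / (s\<^sup>2 + \<theta>\<^sup>2) = (s\<^sup>2 * (s * y\<^sup>2)) / (s\<^sup>2 * (1 + s * y\<^sup>2))"
    unfolding th2 den by (simp only: num)
  also have "\<dots> = (s * y\<^sup>2) / (1 + s * y\<^sup>2)"
    by (rule mult_divide_mult_cancel_left) (use s_pos in simp)
  also have "\<dots> = s * X"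
    unfolding X_def by (rule times_divide_eq_right[symmetric])
  finally have "\<theta>\<^sup>2 / (s\<^sup>2 + \<theta>\<^sup>2) = s * X" .
  moreover have "a / s * (s * x) = a * x" for a x using s_pos by simp
  ultimately have "2.776 * X - 1 / 100 \<le> decay c N r \<theta>"
    using decay_ge_near[OF th ths] by (simp only:)
  then have "2776/1000 * X - 1 / 100 \<le> decay c N r \<theta>" by simp
  \<comment> \<open>Lowering 2.776 to 2.76 pays for the truncation error, since 0.016 * 0.7 >
    1/100.\<close>
  moreover have "7/10 \<le> X"
  proof -
    have "s * y\<^sup>2 \<le> 0.0969 * y\<^sup>2" using s_le by (intro mult_right_mono) auto
    then have "s * y\<^sup>2 \<le> 969/10000 * y\<^sup>2" by simp
    moreover have "98/100 \<le> y\<^sup>2" using Y by simp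
    moreover have "7/10 * (1 + w) \<le> q" if "w \<le> 969/10000 * q" "98/100 \<le> q" for w q :: real
      using that by simp
    ultimately have "7/10 * (1 + s * y\<^sup>2) \<le> y\<^sup>2" by blast
    then show ?thesis unfolding X_def pos_le_divide_eq[OF pos] .
  qed
  ultimately have "276/100 * X \<le> decay c N r \<theta>" by linarith
  moreover have "2.76 * y\<^sup>2 / (1 + s * y\<^sup>2) = 276/100 * X"
    unfolding X_def by simp
  ultimately have "2.76 * y\<^sup>2 / (1 + s * y\<^sup>2) \<le> decay c N r \<theta>"
    by (simp only:)
  from integrand_ge_of_decay[OF this]
  have integrand: "- (V * (1 - cos \<theta>)) \<le> integrand \<theta>" by (simp only: V_def)
  have "V * (a * b / 2) = a / 2 * (b * V)" for a b by simp
  then have "- (t ^ 6 / 2 * (y\<^sup>2 * V)) = - (V * (\<theta>\<^sup>2 / 2))"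
    unfolding th2 t_6 by (simp only:)
  also have "\<dots> \<le> - (V * (1 - cos \<theta>))"
    by (intro le_imp_neg_le mult_left_mono one_minus_cos_le) (simp add: V_def)
  also note integrand
  finally show ?thesis by (simp only: \<theta>_def V_def)
qed

lemma integral_main:
  "16/1000 * t ^ 9 \<le> integral {0..t ^ 3 * (4/5)} integrand"
proof -
  \<comment> \<open>The inner derivative t^-3 turns t^9 into the t^6 of
    \<open>integrand_ge_main\<close>.\<close>
  define F where "F \<theta> = 0.49995 * t ^ 9 * (main_poly (\<theta> / t ^ 3) * exp (- 4.935 * (\<theta> / t ^ 3)\<^sup>2))" for \<theta>
  have "\<exists>F'. (F has_real_derivative F') (at \<theta>) \<and> (0 \<le> \<theta> \<and> \<theta> \<le> t ^ 3 * (4/5) \<longrightarrow> F' \<le> integrand \<theta>)" for \<theta>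
  proof -
    define y where "y = \<theta> / t ^ 3"
    obtain M' where M': "((\<lambda>y. main_poly y * exp (- 4.935 * y\<^sup>2)) has_real_derivative M') (at y)"
      "y \<ge> 0 \<Longrightarrow> M' \<le> y\<^sup>2 * (1 - 1.26 * y ^ 6) * exp (- 4.935 * y\<^sup>2)"
      using main_poly_derivative[of y] by blast
    have d: "((\<lambda>\<theta>. \<theta> / t ^ 3) has_real_derivative 1 / t ^ 3) (at \<theta>)"
      by (rule DERIV_cdivide[OF DERIV_ident])
    have "(F has_real_derivative 0.49995 * t ^ 9 * (M' * (1 / t ^ 3))) (at \<theta>)"
      unfolding F_def by (intro DERIV_cmult DERIV_chain2[OF _ d]) (rule M'(1)[unfolded y_def])
    moreover have "0.49995 * t ^ 9 * (M' * (1 / t ^ 3)) \<le> integrand \<theta>" if "0 \<le> \<theta>" "\<theta> \<le> t ^ 3 * (4/5)"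
    proof -
      have th: "\<theta> = t ^ 3 * y" using t_pos by (simp add: y_def)
      have y: "0 \<le> y" "y \<le> 0.8" using that t_pos by (auto simp: y_def pos_divide_le_eq mult.commute)
      have t9: "t ^ 9 = t ^ 6 * t ^ 3" by (simp flip: power_add)
      have cancel: "k * (a * q) * (b * (1 / q)) = k * a * b" if "q \<noteq> 0" for k a b q :: real
        using that by simp
      have "0.49995 * t ^ 9 * (M' * (1 / t ^ 3)) = 0.49995 * t ^ 6 * M'"
        unfolding t9 by (rule cancel) (use t_pos in simp)
      also have "\<dots> \<le> 0.49995 * t ^ 6 * (y\<^sup>2 * (1 - 1.26 * y ^ 6) * exp (- 4.935 * y\<^sup>2))"
        using M'(2)[OF y(1)] t_pos by (intro mult_left_mono) auto
      also have "\<dots> \<le> integrand \<theta>" unfolding th by (rule integrand_ge_main[OF y])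
      finally show ?thesis .
    qed
    ultimately show ?thesis by blast
  qed
  then have "\<forall>\<theta>. \<exists>F'. (F has_real_derivative F') (at \<theta>) \<and> (0 \<le> \<theta> \<and> \<theta> \<le> t ^ 3 * (4/5) \<longrightarrow> F' \<le> integrand \<theta>)"
    by blast
  from choice[OF this] obtain F' where F': "\<And>\<theta>. (F has_real_derivative F' \<theta>) (at \<theta>)"
    "\<And>\<theta>. 0 \<le> \<theta> \<Longrightarrow> \<theta> \<le> t ^ 3 * (4/5) \<Longrightarrow> F' \<theta> \<le> integrand \<theta>" by blast
  have "F (t ^ 3 * (4/5)) - F 0 \<le> integral {0..t ^ 3 * (4/5)} integrand"
    using t_pos by (intro integral_ge_antiderivative[where F' = F'] F' integrand_integrable) auto
  moreover have "F 0 = 0" by (simp add: F_def main_poly_def)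
  moreover have "16/1000 * t ^ 9 \<le> F (t ^ 3 * (4/5))"
  proof -
    have "t ^ 3 * (4/5) / t ^ 3 = 0.8" using t_pos by simp
    then have F: "F (t ^ 3 * (4/5)) = 0.49995 * t ^ 9 * (main_poly 0.8 * exp (- 4.935 * 0.8\<^sup>2))"
      by (simp only: F_def)
    have "16/1000 * t ^ 9 \<le> 0.49995 * t ^ 9 * 0.034" using t_pos by simp
    also have "\<dots> \<le> F (t ^ 3 * (4/5))"
      unfolding F using t_pos main_poly_value by (intro mult_left_mono) auto
    finally show ?thesis .
  qed
  ultimately show ?thesis by linarith
qed

lemma integral_main_end: "0 \<le> integral {t ^ 3 * (4/5)..t ^ 3 * (99/100)} integrand"
proof (rule Henstock_Kurzweil_Integration.integral_nonneg[OF integrand_integrable])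
  fix \<theta> assume th: "\<theta> \<in> {t ^ 3 * (4/5)..t ^ 3 * (99/100)}"
  define y where "y = \<theta> / t ^ 3"
  have "\<theta> = t ^ 3 * y" using t_pos by (simp add: y_def)
  moreover have "t ^ 3 * (4/5) \<ge> 0" using t_pos by simp
  then have "0 \<le> y" "y \<le> 99/100" using th t_pos by (auto simp: y_def pos_divide_le_eq mult.commute)
  ultimately show "0 \<le> integrand \<theta>" using cos_phase_nonneg[of y] by (simp add: integrand_def)
qed

lemma t_cube_s: "t ^ 3 * (99/100) \<le> s"
proof -
  have "t ^ 3 * (99/100) = s * (t * 0.99)" by (simp add: t_cube)
  also have "\<dots> \<le> s * 1" using t_le s_pos by (intro mult_left_mono) auto
  finally show ?thesis by simp
qed

lemma integral_tail:
  "- (14/1000 * t ^ 9) \<le> integral {t ^ 3 * (99/100)..s} integrand"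
proof -
  define F where "F \<theta> = t ^ 9 / 2 * tail_fun s (\<theta> / t ^ 3)" for \<theta>
  have "\<exists>F'. t ^ 3 * (99/100) \<le> \<theta> \<and> \<theta> \<le> s \<longrightarrow> (F has_real_derivative F') (at \<theta>) \<and> F' \<le> integrand \<theta>" for \<theta>
  proof (cases "t ^ 3 * (99/100) \<le> \<theta> \<and> \<theta> \<le> s")
    case True
    define y where "y = \<theta> / t ^ 3"
    have th: "\<theta> = t ^ 3 * y" using t_pos by (simp add: y_def)
    have y: "0.99 \<le> y" using True t_pos by (auto simp: y_def pos_le_divide_eq mult.commute)
    have "s * (t * y) \<le> s * 1" using True by (simp add: th t_cube)
    then have "t * y \<le> 1" using s_pos by simp
    then have "(t * y)\<^sup>2 \<le> 1\<^sup>2" using t_pos y by (intro power_mono) auto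
    then have sy: "s * y\<^sup>2 \<le> 1" by (simp add: power_mult_distrib t_sq)
    obtain G' where G': "(tail_fun s has_real_derivative G') (at y)"
      "G' \<le> - (y\<^sup>2 * exp (- (2.76 * y\<^sup>2 / (1 + s * y\<^sup>2))))"
      using tail_fun_derivative[OF s_pos s_le y sy] by blast
    have d: "((\<lambda>\<theta>. \<theta> / t ^ 3) has_real_derivative 1 / t ^ 3) (at \<theta>)"
      by (rule DERIV_cdivide[OF DERIV_ident])
    have "(F has_real_derivative t ^ 9 / 2 * (G' * (1 / t ^ 3))) (at \<theta>)"
      unfolding F_def by (intro DERIV_cmult DERIV_chain2[OF _ d]) (rule G'(1)[unfolded y_def])
    moreover have "t ^ 9 / 2 * (G' * (1 / t ^ 3)) \<le> integrand \<theta>"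
    proof -
      have t9: "t ^ 9 = t ^ 6 * t ^ 3" by (simp flip: power_add)
      have cancel: "a * q / 2 * (b * (1 / q)) = a / 2 * b" if "q \<noteq> 0" for a b q :: real
        using that by simp
      have "t ^ 9 / 2 * (G' * (1 / t ^ 3)) = t ^ 6 / 2 * G'"
        unfolding t9 by (rule cancel) (use t_pos in simp)
      also have "\<dots> \<le> t ^ 6 / 2 * (- (y\<^sup>2 * exp (- (2.76 * y\<^sup>2 / (1 + s * y\<^sup>2)))))"
        using G'(2) t_pos by (intro mult_left_mono) auto
      also have "\<dots> \<le> integrand \<theta>" unfolding th using integrand_ge_tail[OF y sy] by simp
      finally show ?thesis .
    qed
    ultimately show ?thesis by blast
  qed auto
  then have "\<forall>\<theta>. \<exists>F'. t ^ 3 * (99/100) \<le> \<theta> \<and> \<theta> \<le> s \<longrightarrow> (F has_real_derivative F') (at \<theta>) \<and> F' \<le> integrand \<theta>"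
    by blast
  from choice[OF this] obtain F' where F': "\<And>\<theta>. t ^ 3 * (99/100) \<le> \<theta> \<Longrightarrow> \<theta> \<le> s \<Longrightarrow> (F has_real_derivative F' \<theta>) (at \<theta>)"
    "\<And>\<theta>. t ^ 3 * (99/100) \<le> \<theta> \<Longrightarrow> \<theta> \<le> s \<Longrightarrow> F' \<theta> \<le> integrand \<theta>" by blast
  have "F s - F (t ^ 3 * (99/100)) \<le> integral {t ^ 3 * (99/100)..s} integrand"
    using t_cube_s by (intro integral_ge_antiderivative[where F' = F'] F' integrand_integrable) auto
  moreover have "F s \<ge> 0" using t_pos s_pos by (simp add: F_def tail_fun_def)
  moreover have "F (t ^ 3 * (99/100)) \<le> 14/1000 * t ^ 9"
  proof -
    have "t ^ 3 * (99/100) / t ^ 3 = 0.99" using t_pos by simp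
    then have "F (t ^ 3 * (99/100)) = t ^ 9 / 2 * tail_fun s 0.99"
      by (simp only: F_def)
    also have "\<dots> \<le> t ^ 9 / 2 * 0.0263"
      using t_pos tail_fun_value[OF s_pos s_le] by (intro mult_left_mono) auto
    also have "\<dots> \<le> 14/1000 * t ^ 9" using t_pos by simp
    finally show ?thesis .
  qed
  ultimately show ?thesis by linarith
qed

text \<open>The weight \<theta>^2 / 2 integrates to 62/3 t^6, and the remaining t^3 is extracted
  from \<open>C\<close>. Lowering 1.388 to 1.38 pays for the truncation error because 0.008 / s >
  1/100.\<close>

lemma integral_middle:
  "- (5/10000 * t ^ 9) \<le> integral {s..5 * s} integrand"
proof -
  define C where "C = exp (- 1.38 / t\<^sup>2)"
  have C: "C \<ge> 0" by (simp add: C_def)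
  define F where "F \<theta> = - (C * \<theta> ^ 3 / 6)" for \<theta>
  have "F (5 * s) - F s \<le> integral {s..5 * s} integrand"
  proof (rule integral_ge_antiderivative[OF _ integrand_integrable])
    fix \<theta> assume th: "s \<le> \<theta>" "\<theta> \<le> 5 * s"
    show "(F has_real_derivative - (C * (\<theta>\<^sup>2 / 2))) (at \<theta>)"
      unfolding F_def[abs_def] by (auto intro!: derivative_eq_intros)
    have "0.008 / s \<ge> 1 / 100" using s_pos s_le by (simp add: field_simps)
    then have "1.38 / s \<le> decay c N r \<theta>" using decay_ge_middle[OF th] by (simp add: field_simps)
    from integrand_ge_of_decay[OF this] have "- (C * (1 - cos \<theta>)) \<le> integrand \<theta>" by (simp add: C_def t_sq)
    moreover have "C * (1 - cos \<theta>) \<le> C * (\<theta>\<^sup>2 / 2)" using C by (intro mult_left_mono one_minus_cos_le)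
    ultimately show "- (C * (\<theta>\<^sup>2 / 2)) \<le> integrand \<theta>" by linarith
  qed (use s_pos in auto)
  moreover have "F (5 * s) - F s = - (C * (62 / 3 * t ^ 6))"
    by (simp add: F_def power_mult_distrib t_6)
  moreover have "C * (62 / 3 * t ^ 6) \<le> 5/10000 * t ^ 9"
  proof -
    have "C \<le> exp (- 1.38 / 0.3113\<^sup>2) * (t / 0.3113) ^ 3"
      unfolding C_def using t_pos t_le by (intro exp_inverse_square_le) (simp_all add: power2_eq_square)
    also have "\<dots> \<le> 7.2 / 10 ^ 7 * (t / 0.3113) ^ 3"
    proof (intro mult_right_mono)
      have "exp (- 1.38 / 0.3113\<^sup>2) \<le> exp (- (real 16 * (0.89 :: real)))" by (simp add: power2_eq_square)
      also have "\<dots> = inverse (exp (real 16 * 0.89))" by (rule exp_minus)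
      also have "\<dots> \<le> inverse (2.434 ^ 16)"
        by (intro le_imp_inverse_le exp_ge_power) (simp_all add: power_numeral_reduce)
      also have "\<dots> \<le> 7.2 / 10 ^ 7" by (simp add: power_numeral_reduce)
      finally show "exp (- 1.38 / 0.3113\<^sup>2) \<le> (7.2 / 10 ^ 7 :: real)" .
    qed (use t_pos in auto)
    also have "\<dots> = 7.2 / 10 ^ 7 / 0.3113 ^ 3 * t ^ 3" by (simp add: power_divide)
    also have "\<dots> \<le> 2.41 / 10 ^ 5 * t ^ 3" using t_pos by (intro mult_right_mono) (auto simp: power3_eq_cube)
    finally have "C * (62 / 3 * t ^ 6) \<le> (2.41 / 10 ^ 5 * t ^ 3) * (62 / 3 * t ^ 6)"
      using t_pos by (intro mult_right_mono) auto
    also have "\<dots> = 2.41 / 10 ^ 5 * 62 / 3 * t ^ 9" by (simp flip: power_add)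
    also have "\<dots> \<le> 5/10000 * t ^ 9" using t_pos by (intro mult_right_mono) auto
    finally show ?thesis .
  qed
  ultimately show ?thesis by linarith
qed

lemma five_s_le_pi: "5 * s \<le> pi"
  using s_le pi_gt3 by simp

text \<open>The weight is bounded by 2 and supplies no power of t, so all of t^9 is extracted from
  \<open>C\<close>.\<close>

lemma integral_far:
  "- (8/10000 * t ^ 9) \<le> integral {5 * s..pi} integrand"
proof -
  define C where "C = exp (- 1.9 / t\<^sup>2)"
  have C: "C \<ge> 0" by (simp add: C_def)
  have "- (2 * C) * pi - - (2 * C) * (5 * s) \<le> integral {5 * s..pi} integrand"
  proof (rule integral_ge_antiderivative[OF five_s_le_pi integrand_integrable])
    fix \<theta> assume th: "5 * s \<le> \<theta>" "\<theta> \<le> pi"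
    show "((\<lambda>\<theta>. - (2 * C) * \<theta>) has_real_derivative - (2 * C)) (at \<theta>)"
      by (auto intro!: derivative_eq_intros)
    have "0.01 / s \<ge> 1 / 100" using s_pos s_le by (simp add: field_simps)
    then have "1.9 / s \<le> decay c N r \<theta>" using decay_ge_far[OF th] by (simp add: field_simps)
    from integrand_ge_of_decay[OF this] have "- (C * (1 - cos \<theta>)) \<le> integrand \<theta>" by (simp add: C_def t_sq)
    moreover have "C * (1 - cos \<theta>) \<le> C * 2" 
    proof (intro mult_left_mono C)
      show "1 - cos \<theta> \<le> 2" using cos_ge_minus_one[of \<theta>] by linarith
    qed
    ultimately show "- (2 * C) \<le> integrand \<theta>" by linarith
  qed
  moreover have "2 * C * (5 * s) \<ge> 0" using C s_pos by simp
  moreover have "C * (2 * pi) \<le> 8/10000 * t ^ 9"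
  proof -
    have "C \<le> exp (- 1.9 / 0.3113\<^sup>2) * (t / 0.3113) ^ 9"
      unfolding C_def using t_pos t_le by (intro exp_inverse_square_le) (simp_all add: power2_eq_square)
    also have "\<dots> \<le> 3.3 / 10 ^ 9 * (t / 0.3113) ^ 9"
    proof (intro mult_right_mono)
      have "exp (- 1.9 / 0.3113\<^sup>2) \<le> exp (- (real 20 * (0.98 :: real)))" by (simp add: power2_eq_square)
      also have "\<dots> = inverse (exp (real 20 * 0.98))" by (rule exp_minus)
      also have "\<dots> \<le> inverse (2.66 ^ 20)"
        by (intro le_imp_inverse_le exp_ge_power) (simp_all add: power_numeral_reduce)
      also have "\<dots> \<le> 3.3 / 10 ^ 9" by (simp add: power_numeral_reduce)
      finally show "exp (- 1.9 / 0.3113\<^sup>2) \<le> (3.3 / 10 ^ 9 :: real)" .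
    qed (use t_pos in auto)
    also have "\<dots> = 3.3 / 10 ^ 9 / 0.3113 ^ 9 * t ^ 9" by (simp add: power_divide)
    also have "\<dots> \<le> 0.000125 * t ^ 9" using t_pos by (intro mult_right_mono) (auto simp: power_numeral_reduce)
    finally have "C * (2 * pi) \<le> (0.000125 * t ^ 9) * (2 * 3.2)"
      using t_pos C pi_approx by (intro mult_mono) auto
    then show ?thesis by simp
  qed
  ultimately show ?thesis by simp
qed

lemma integral_integrand_nonneg: "0 \<le> integral {0..pi} integrand"
proof -
  have I: "integral {a..b} integrand + integral {b..d} integrand = integral {a..d} integrand" if "a \<le> b" "b \<le> d" for a b d
    using that by (intro Henstock_Kurzweil_Integration.integral_combine integrand_integrable)
  have o: "0 \<le> t ^ 3 * (4/5)" "t ^ 3 * (4/5) \<le> t ^ 3 * (99/100)" "t ^ 3 * (99/100) \<le> s" "s \<le> 5 * s" "5 * s \<le> pi"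
    using t_pos s_pos t_cube_s five_s_le_pi by auto
  have "integral {0..pi} integrand = integral {0..t ^ 3 * (4/5)} integrand + integral {t ^ 3 * (4/5)..t ^ 3 * (99/100)} integrand
      + integral {t ^ 3 * (99/100)..s} integrand + integral {s..5 * s} integrand + integral {5 * s..pi} integrand"
  proof -
    have 0: "0 \<le> t ^ 3 * (99/100)" "0 \<le> s" "0 \<le> 5 * s" using o by linarith+
    show ?thesis
      using I[OF o(1,2)] I[OF 0(1) o(3)] I[OF 0(2) o(4)] I[OF 0(3) o(5)] by linarith
  qed
  moreover have "t ^ 9 \<ge> 0" using t_pos by simp
  ultimately show ?thesis
    using integral_main integral_main_end integral_tail integral_middle integral_far by linarith
qed

end

section \<open>Log-concavity\<close>

lemma has_integral_reflect_about:
  fixes h :: "real \<Rightarrow> real"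
  assumes "(h has_integral I) {a..b}"
  shows "((\<lambda>x. h (d - x)) has_integral I) {d - b..d - a}"
proof -
  have "(h has_integral I) (cbox a b)" using assms by simp
  from has_integral_affinity[OF this, of "-1" d] show ?thesis
    by (simp add: image_affinity_atLeastAtMost algebra_simps)
qed

lemma euler_fun_cnj: "euler_fun c N (cnj z) = cnj (euler_fun c N z)"
  by (simp add: euler_fun_def)

text \<open>Passing from n to n - 1 or n + 1 multiplies the kernel by cis \<theta> or its conjugate,
  whose sum is 2 cos \<theta>.\<close>

lemma Re_cis_second_difference:
  "2 * Re (w * cis (- (real n * \<theta>))) - Re (w * cis (- (real (n - 1) * \<theta>))) - Re (w * cis (- (real (n + 1) * \<theta>)))
     = 2 * (Re (w * cis (- (real n * \<theta>))) * (1 - cos \<theta>))" if "n \<ge> 1"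
proof -
  have "cis (- (real (n - 1) * \<theta>)) = cis (- (real n * \<theta>)) * cis \<theta>"
    using that by (simp add: cis_mult of_nat_diff algebra_simps)
  moreover have "cis (- (real (n + 1) * \<theta>)) = cis (- (real n * \<theta>)) * cis (- \<theta>)"
    by (simp add: cis_mult algebra_simps)
  moreover have "2 * w * v - w * (v * cis \<theta>) - w * (v * cis (- \<theta>)) = w * v * of_real (2 * (1 - cos \<theta>))" for v
    by (simp add: complex_eq_iff algebra_simps)
  ultimately have "2 * (w * cis (- (real n * \<theta>))) - w * cis (- (real (n - 1) * \<theta>)) - w * cis (- (real (n + 1) * \<theta>))
     = w * cis (- (real n * \<theta>)) * of_real (2 * (1 - cos \<theta>))" by (simp only: mult.assoc)
  then have "Re (2 * (w * cis (- (real n * \<theta>))) - w * cis (- (real (n - 1) * \<theta>)) - w * cis (- (real (n + 1) * \<theta>)))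
     = Re (w * cis (- (real n * \<theta>)) * of_real (2 * (1 - cos \<theta>)))" by (simp only:)
  then show ?thesis by simp
qed

lemma square_ge_of_weighted:
  fixes a b d r :: real
  assumes "r > 0" "n \<ge> 1" "a \<ge> 0" "d \<ge> 0" and "a * r ^ (n - 1) + d * r ^ (n + 1) \<le> 2 * (b * r ^ n)"
  shows "a * d \<le> b\<^sup>2"
proof -
  define p q where "p = a * r ^ (n - 1)" and "q = d * r ^ (n + 1)"
  have pq: "p \<ge> 0" "q \<ge> 0" using assms by (auto simp: p_def q_def)
  have "r ^ (n - 1) * r ^ (n + 1) = (r ^ n)\<^sup>2"
    using assms(2) by (cases n) (simp_all add: power2_eq_square)
  then have "p * q = (a * d) * (r ^ n)\<^sup>2" by (simp add: p_def q_def algebra_simps)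
  moreover have "4 * (p * q) \<le> (p + q)\<^sup>2"
  proof -
    have "(p + q)\<^sup>2 - 4 * (p * q) = (p - q)\<^sup>2" by (simp add: power2_eq_square algebra_simps)
    then show ?thesis using zero_le_power2[of "p - q"] by linarith
  qed
  moreover have "(p + q)\<^sup>2 \<le> (2 * (b * r ^ n))\<^sup>2"
    using assms(5) pq by (intro power_mono) (auto simp: p_def q_def)
  moreover have "(2 * (b * r ^ n))\<^sup>2 = 4 * (b\<^sup>2 * (r ^ n)\<^sup>2)" by (simp add: power_mult_distrib)
  ultimately have "(a * d) * (r ^ n)\<^sup>2 \<le> b\<^sup>2 * (r ^ n)\<^sup>2" by linarith
  then show ?thesis using assms(1) by simp
qed

lemma (in saddle) log_concave_at:
  "fps_nth (euler_prod c N) (n - 1) * fps_nth (euler_prod c N) (n + 1) \<le> (fps_nth (euler_prod c N :: real fps) n)\<^sup>2"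
proof -
  define e where "e i = fps_nth (euler_prod c N :: real fps) i * r ^ i" for i
  define K where "K = exp (- (\<Sum>m=1..N. real (c m) * ln (1 - r ^ m)))"
  define h where "h \<theta> = Re (euler_fun c N (of_real r * cis \<theta>) * cis (- (real n * \<theta>))) * (1 - cos \<theta>)" for \<theta>
  have n1: "n \<ge> 1" using n_ge by simp
  have e: "((\<lambda>\<theta>. Re (euler_fun c N (of_real r * cis \<theta>) * cis (- (real i * \<theta>)))) has_integral 2 * pi * e i) {0..2*pi}" for i
    unfolding e_def by (rule euler_prod_coeff_integral[OF r01])
  have "((\<lambda>\<theta>. 2 * h \<theta>) has_integral 2 * (2 * pi * e n) - 2 * pi * e (n - 1) - 2 * pi * e (n + 1)) {0..2*pi}"
    unfolding h_def Re_cis_second_difference[OF n1, symmetric]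
    by (intro has_integral_diff has_integral_mult_right e)
  from has_integral_mult_right[OF this, of "1/2"]
  have h: "(h has_integral pi * (2 * e n - e (n - 1) - e (n + 1))) {0..2*pi}"
    by (simp add: algebra_simps)
  have hf: "h = (\<lambda>\<theta>. K * integrand \<theta>)"
    by (rule ext) (simp only: h_def integrand_def K_def euler_fun_polar[OF r01] mult.assoc)
  have i1: "(h has_integral K * integral {0..pi} integrand) {0..pi}"
    unfolding hf by (intro has_integral_mult_right integrable_integral integrand_integrable)
  \<comment> \<open>Real coefficients make \<theta> \<mapsto> 2 pi - \<theta> a conjugation, so both
    halves of the circle contribute equally.\<close>
  have refl: "h (2 * pi - \<theta>) = h \<theta>" for \<theta>
  proof -
    have c1: "cis (2 * pi - \<theta>) = cnj (cis \<theta>)"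
      by (simp add: complex_eq_iff cos_diff sin_diff)
    have "cis (- (real n * (2 * pi - \<theta>))) = cis (2 * pi * of_int (- int n)) * cis (real n * \<theta>)"
      by (simp add: cis_mult algebra_simps)
    also have "cis (2 * pi * of_int (- int n)) = 1" by (intro cis_multiple_2pi) auto
    finally have "cis (- (real n * (2 * pi - \<theta>))) = cnj (cis (- (real n * \<theta>)))"
      by (simp add: cis_cnj)
    then have "euler_fun c N (of_real r * cis (2 * pi - \<theta>)) * cis (- (real n * (2 * pi - \<theta>)))
      = cnj (euler_fun c N (of_real r * cis \<theta>) * cis (- (real n * \<theta>)))"
      by (simp add: c1 flip: euler_fun_cnj)
    moreover have "cos (2 * pi - \<theta>) = cos \<theta>" by (simp add: cos_diff)
    ultimately show ?thesis by (simp only: h_def complex_cnj)  simp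
  qed
  have i2: "(h has_integral K * integral {0..pi} integrand) {pi..2*pi}"
    using has_integral_reflect_about[OF i1, of "2 * pi"] by (simp add: refl)
  have "(h has_integral K * integral {0..pi} integrand + K * integral {0..pi} integrand) {0..2*pi}"
    by (rule has_integral_combine[OF _ _ i1 i2]) auto
  with h have "pi * (2 * e n - e (n - 1) - e (n + 1)) = K * integral {0..pi} integrand + K * integral {0..pi} integrand"
    by (rule has_integral_unique)
  also have "\<dots> \<ge> 0" using integral_integrand_nonneg by (simp add: K_def)
  finally have "e (n - 1) + e (n + 1) \<le> 2 * e n"
    using pi_gt_zero by (simp add: zero_le_mult_iff)
  then show ?thesis
    using euler_prod_nonneg n1 r01
    by (intro square_ge_of_weighted[where r = r and n = n]) (auto simp: e_def)
qed

text \<open>Intermediate value theorem on [0, n / (n + 2)]. The right end solves 2 R / (1 - R) = n,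
  so the term m = 1 alone, with at least two colours, already reaches n there.\<close>

lemma saddle_point_exists:
  fixes c :: "nat \<Rightarrow> nat"
  assumes c: "\<And>m. 2 \<le> c m" and n: "n \<ge> 1" and N: "N \<ge> 1"
  obtains r where "0 < r" "r \<le> real n / real (n + 2)"
    "(\<Sum>m=1..N. real (c m) * (real m * (r ^ m / (1 - r ^ m)))) = real n"
proof -
  define M where "M r = (\<Sum>m=1..N. real (c m) * (real m * (r ^ m / (1 - r ^ m))))" for r :: real
  define R where "R = real n / real (n + 2)"
  have R: "0 < R" "R < 1" using n by (auto simp: R_def)
  have "continuous_on {0..R} M"
    unfolding M_def
  proof (intro continuous_intros ballI)
    fix m r assume "m \<in> {1..N}" "r \<in> {0..R}"
    then have "r ^ m < 1" using R by (auto simp: power_less_one_iff)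
    then show "1 - r ^ m \<noteq> 0" by simp
  qed
  moreover have "M 0 = 0" unfolding M_def by (intro sum.neutral) auto
  moreover have "real n \<le> M R"
  proof -
    have nn: "0 \<le> real (c m) * (real m * (R ^ m / (1 - R ^ m)))" for m
      using R by (intro mult_nonneg_nonneg divide_nonneg_nonneg) (auto simp: power_le_one)
    have "real n = 2 * (R / (1 - R))" by (simp add: R_def field_simps)
    also have "\<dots> \<le> real (c 1) * (real 1 * (R ^ 1 / (1 - R ^ 1)))"
      using c[of 1] R by (simp add: mult_right_mono del: times_divide_eq_right)
    also have "\<dots> \<le> M R"
      unfolding M_def using N by (intro member_le_sum nn) auto
    finally show ?thesis .
  qed
  ultimately obtain r where r: "0 \<le> r" "r \<le> R" "M r = real n"
    using IVT'[of M 0 "real n" R] R by auto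
  have "r \<noteq> 0" using r \<open>M 0 = 0\<close> n by auto
  show ?thesis
  proof (rule that)
    show "0 < r" using r(1) \<open>r \<noteq> 0\<close> by simp
    show "r \<le> real n / real (n + 2)" using r(2) by (simp only: R_def)
    show "(\<Sum>m=1..N. real (c m) * (real m * (r ^ m / (1 - r ^ m)))) = real n"
      using r(3) by (simp only: M_def)
  qed
qed

text \<open>The weight n / (n + 2) bounds the saddle point uniformly in N, so the truncation
  error of the product can be made as small as required.\<close>

lemma euler_prod_log_concave:
  fixes c :: "nat \<Rightarrow> nat"
  assumes c: "\<And>m. 2 \<le> c m" "\<And>m. c m \<le> 3" and n: "n \<ge> 526"
  obtains N where "n + 1 \<le> N"
    "fps_nth (euler_prod c N) (n - 1) * fps_nth (euler_prod c N) (n + 1) \<le> (fps_nth (euler_prod c N :: real fps) n)\<^sup>2"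
proof -
  define R where "R = real n / real (n + 2)"
  have R: "0 < R" "R < 1" using n by (auto simp: R_def)
  have "(\<lambda>N. R ^ N) \<longlonglongrightarrow> 0" using R by (intro LIMSEQ_realpow_zero) auto
  \<comment> \<open>1600 = 16 * 100 matches the requirement \<open>tail\<close> of the
    locale.\<close>
  then have "eventually (\<lambda>N. R ^ N < (1 - R) / 1600) sequentially"
    using R by (intro order_tendstoD) auto
  then obtain N0 where N0: "\<And>N. N \<ge> N0 \<Longrightarrow> R ^ N < (1 - R) / 1600"
    unfolding eventually_sequentially by blast
  define N where "N = max N0 (n + 1)"
  have n1: "n \<ge> 1" and N1: "N \<ge> 1" using n by (auto simp: N_def)
  obtain r where r: "0 < r" "r \<le> R"
    "(\<Sum>m=1..N. real (c m) * (real m * (r ^ m / (1 - r ^ m)))) = real n"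
    by (rule saddle_point_exists[OF c(1) n1 N1, folded R_def]) (erule (2) that)
  have tail: "16 * r ^ Suc N / (1 - r) \<le> 1 / 100"
  proof -
    have "r ^ Suc N \<le> R ^ Suc N" using r by (intro power_mono) auto
    also have "\<dots> \<le> (1 - R) / 1600"
      by (intro less_imp_le N0) (simp add: N_def)
    also have "\<dots> \<le> (1 - r) / 1600"
      using r(2) by (intro divide_right_mono) auto
    finally have "16 * r ^ Suc N \<le> 16 * ((1 - r) / 1600)"
      by (intro mult_left_mono) auto
    also have "\<dots> = 1 / 100 * (1 - r)" by simp
    finally have "16 * r ^ Suc N \<le> 1 / 100 * (1 - r)" .
    moreover have "1 - r > 0" using r R by simp
    ultimately show ?thesis by (simp only: pos_divide_le_eq)
  qed
  interpret saddle c N n "- ln r" r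
  proof
    show "- ln r > 0" using r R by simp
    show "r = exp (- (- ln r))" using r(1) by simp
  qed (fact c r(3) n tail)+
  show ?thesis
    by (rule that[OF _ log_concave_at]) (simp add: N_def)
qed

theorem theorem1p5:
  fixes k n :: nat
  assumes "k \<ge> 3"
    and "real n \<ge> of_int \<lceil>8 * real k ^ 3 + (real k + 1) / 12\<rceil>"
    and "n \<ge> 526"
  shows "Delta k n ^ 2 \<ge> Delta k (n - 1) * Delta k (n + 1)"
proof -
  have "2 \<le> colours k m" "colours k m \<le> 3" for m by (auto simp: colours_def)
  then obtain N where N: "n + 1 \<le> N" "fps_nth (euler_prod (colours k) N) (n - 1) * fps_nth (euler_prod (colours k) N) (n + 1)
      \<le> (fps_nth (euler_prod (colours k) N :: real fps) n)\<^sup>2"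
    using euler_prod_log_concave[of "colours k" n] assms(3) by blast
  have "Delta k i = fps_nth (euler_prod (colours k) N) i" if "i \<le> n + 1" for i
    using that N(1) by (intro Delta_eq_euler_prod) simp
  then show ?thesis using N(2) by simp
qed

end
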